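(* If a probability density function $f$ over $\mathbb{R}^n$ satisfies \[ \int_0^\infty\Big(\sup_{\mathbf{z}:\,\Vert\mathbf{z}\Vert\ge x}f(\mathbf{z})\Big)x^{n-1}\log(1+x)\,\mathrm{d}x<\infty, \] then there exists a layered rejection-sampled universal quantizer (LRSUQ) $Q_{f,\mathcal{P}}$ for $f$ (i.e., there exist a lattice in $\mathbb{R}^n$, a basic cell $\mathcal{P}$ of it, and an admissible scaling function $\beta$) with normalized entropy \[ \overline{H}(Q_{f,\mathcal{P}})\le-h_L(f)+\log e. \]
   Context: Conventions: $\log$ is to base $2$; $H(\cdot|\cdot)$ is conditional Shannon entropy in bits; $\mu$ is Lebesgue measure on $\mathbb{R}^n$; $B^n$ is the closed unit ball; sets and functions are measurable as needed. For $f:\mathbb{R}^n\to[0,\infty)$ the superlevel set is $L_t^+(f):=\{\mathbf{z}\in\mathbb{R}^n:f(\mathbf{z})\ge t\}$. The layered entropy of a probability density function $f$ is $h_L(f):=\int_0^\infty\mu(L_t^+(f))\log\mu(L_t^+(f))\,\mathrm{d}t$. For full-rank $\mathbf{G}\in\mathbb{R}^{n\times n}$, a bounded set $\mathcal{P}\subseteq\mathbb{R}^n$ is a basic cell of the lattice $\mathbf{G}\mathbb{Z}^n$ if the translates $(\mathcal{P}+\mathbf{G}\mathbf{j})_{\mathbf{j}\in\mathbb{Z}^n}$ partition $\mathbb{R}^n$. For a basic cell $\mathcal{P}$, $Q_{\mathcal{P}}(\mathbf{x})$ is the unique lattice point $\mathbf{y}\in\mathbf{G}\mathbb{Z}^n$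 with $\mathbf{x}\in-\mathcal{P}+\mathbf{y}$. LRSUQ: given a basic cell $\mathcal{P}$, a probability density function $f$ with $L_t^+(f)$ bounded for all $t>0$, and $\beta:(0,\infty)\to[0,\infty)$ satisfying $L_t^+(f)\subseteq\beta(t)\mathcal{P}$ for all $t>0$ (an admissible scaling function), the LRSUQ for $f$ against $\mathcal{P}$ is the randomized quantizer with state $S=(T,(\mathbf{V}_i)_{i\ge1})$, where $T$ has probability density function $f_T(t)=\mu(L_t^+(f))$ on $(0,\infty)$, $\mathbf{V}_1,\mathbf{V}_2,\ldots$ are i.i.d. $\mathrm{Unif}(\mathcal{P})$ independent of $T$, and quantization function \[ Q_{f,\mathcal{P}}(\mathbf{x},t,(\mathbf{v}_i)_i):=\beta(t)\cdot\big(Q_{\mathcal{P}}(\mathbf{x}/\beta(t)-\mathbf{v}_k)+\mathbf{v}_k\big),\qquad k:=\min\big\{i:\beta(t)\cdot\big(Q_{\mathcal{P}}(\mathbf{x}/\beta(t)-\mathbf{v}_i)+\mathbf{v}_i\big)-\mathbf{x}\in L_t^+(f)\big\}. \] Normalized entropy: $\overline{H}(Q):=\limsup_{\tau\to\infty}\big(H(Q(\mathbf{X}_\tau,S)|S)-\log\mu(\tau B^n)\big)$, where $\mathbf{X}_\tau\sim\mathrm{Unif}(\tau B^n)$ is independent of $S$. *)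

theory Defs
  imports "HOL-Probability.Probability"
begin

definition is_pdf :: "('a::euclidean_space \<Rightarrow> real) \<Rightarrow> bool" where
  "is_pdf f \<longleftrightarrow> f \<in> borel_measurable borel \<and> (\<forall>z. 0 \<le> f z) \<and> (\<integral>\<^sup>+z. ennreal (f z) \<partial>lborel) = 1"

definition superlevel :: "('a \<Rightarrow> real) \<Rightarrow> real \<Rightarrow> 'a set" where
  "superlevel f t = {z. f z \<ge> t}"

(* A Lebesgue integral on (0,\<infinity>) with values in the extended reals: for an unbounded
   density the layered entropy can be -\<infinity>, which a Bochner integral would report as 0. *)
definition ext_integral_pos :: "(real \<Rightarrow> real) \<Rightarrow> ereal" where
  "ext_integral_pos g =
     enn2ereal (\<integral>\<^sup>+t\<in>{0<..}. ennreal (g t) \<partial>lborel) - enn2ereal (\<integral>\<^sup>+t\<in>{0<..}. ennreal (- g t) \<partial>lborel)"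

definition layered_entropy :: "('a::euclidean_space \<Rightarrow> real) \<Rightarrow> ereal" where
  "layered_entropy f =
     ext_integral_pos (\<lambda>t. measure lborel (superlevel f t) * log 2 (measure lborel (superlevel f t)))"


section \<open>Lattices and basic cells\<close>

definition lattice_point :: "real^'n^'n \<Rightarrow> int^'n \<Rightarrow> real^'n" where
  "lattice_point G j = G *v (\<chi> i. of_int (j $ i))"

definition basic_cell :: "real^'n^'n \<Rightarrow> (real^'n) set \<Rightarrow> bool" where
  "basic_cell G P \<longleftrightarrow> bounded P \<and> P \<in> sets borel \<and>
     disjoint_family (\<lambda>j. (\<lambda>p. p + lattice_point G j) ` P) \<and>
     (\<Union>j. (\<lambda>p. p + lattice_point G j) ` P) = UNIV"

definition cell_quantizer :: "real^'n^'n \<Rightarrow> (real^'n) set \<Rightarrow> real^'n \<Rightarrow> real^'n" where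
  "cell_quantizer G P x = (THE y. y \<in> range (lattice_point G) \<and> x \<in> (\<lambda>p. - p + y) ` P)"


section \<open>Layered rejection-sampled universal quantizers\<close>

definition admissible_scaling :: "('a::euclidean_space \<Rightarrow> real) \<Rightarrow> 'a set \<Rightarrow> (real \<Rightarrow> real) \<Rightarrow> bool" where
  "admissible_scaling f P \<beta> \<longleftrightarrow> \<beta> \<in> borel_measurable borel \<and>
     (\<forall>t>0. 0 \<le> \<beta> t \<and> superlevel f t \<subseteq> (\<lambda>p. \<beta> t *\<^sub>R p) ` P)"

definition dithered_quantizer ::
    "real^'n^'n \<Rightarrow> (real^'n) set \<Rightarrow> real \<Rightarrow> real^'n \<Rightarrow> real^'n \<Rightarrow> real^'n" where
  "dithered_quantizer G P b v x = b *\<^sub>R (cell_quantizer G P (x /\<^sub>R b - v) + v)"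

(* The dither sequence is indexed from 0. *)
definition lrsuq ::
    "(real^'n \<Rightarrow> real) \<Rightarrow> real^'n^'n \<Rightarrow> (real^'n) set \<Rightarrow> (real \<Rightarrow> real)
      \<Rightarrow> real^'n \<Rightarrow> real \<times> (nat \<Rightarrow> real^'n) \<Rightarrow> real^'n" where
  "lrsuq f G P \<beta> x = (\<lambda>(t, v).
     let k = (LEAST i. dithered_quantizer G P (\<beta> t) (v i) x - x \<in> superlevel f t)
     in dithered_quantizer G P (\<beta> t) (v k) x)"

definition lrsuq_state ::
    "('a::euclidean_space \<Rightarrow> real) \<Rightarrow> 'a set \<Rightarrow> (real \<times> (nat \<Rightarrow> 'a)) measure" where
  "lrsuq_state f P =
     density lborel (\<lambda>t. emeasure lborel (superlevel f t) * indicator {0<..} t)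
       \<Otimes>\<^sub>M (\<Pi>\<^sub>M i\<in>(UNIV::nat set). uniform_measure lborel P)"

definition is_lrsuq ::
    "(real^'n \<Rightarrow> real) \<Rightarrow> real^'n^'n \<Rightarrow> (real^'n) set \<Rightarrow> (real \<Rightarrow> real) \<Rightarrow> bool" where
  "is_lrsuq f G P \<beta> \<longleftrightarrow> rank G = CARD('n) \<and> basic_cell G P \<and> is_pdf f \<and>
     (\<forall>t>0. bounded (superlevel f t)) \<and> admissible_scaling f P \<beta>"


section \<open>Conditional entropy and normalized entropy\<close>

(* Shannon entropy in bits of a distribution; infinite if the distribution is not discrete. *)
definition discrete_entropy :: "'b measure \<Rightarrow> ennreal" where
  "discrete_entropy N =
     (if \<exists>C. countable C \<and> (AE y in N. y \<in> C)
      then \<integral>\<^sup>+y. ennreal (- measure N {y} * log 2 (measure N {y})) \<partial>count_space UNIV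
      else \<infinity>)"

(* K is a regular conditional distribution of Y given S. *)
definition cond_law ::
    "'o measure \<Rightarrow> 's measure \<Rightarrow> ('o \<Rightarrow> 'b::topological_space) \<Rightarrow> ('o \<Rightarrow> 's)
      \<Rightarrow> ('s \<Rightarrow> 'b measure) \<Rightarrow> bool" where
  "cond_law M NS Y S K \<longleftrightarrow>
     Y \<in> M \<rightarrow>\<^sub>M borel \<and> S \<in> M \<rightarrow>\<^sub>M NS \<and> K \<in> NS \<rightarrow>\<^sub>M prob_algebra borel \<and>
     (\<forall>A\<in>sets NS. \<forall>B\<in>sets borel.
        emeasure M {w \<in> space M. S w \<in> A \<and> Y w \<in> B}
          = (\<integral>\<^sup>+s\<in>A. emeasure (K s) B \<partial>distr M NS S))"

(* H(Y|S), where S need not be discrete: the entropy of the conditional law of Y given S = s,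
   averaged over s. The value does not depend on the version of the conditional law
   (lemma cond_entropy_eq below). *)
definition cond_entropy ::
    "'o measure \<Rightarrow> 's measure \<Rightarrow> ('o \<Rightarrow> 'b::second_countable_topology) \<Rightarrow> ('o \<Rightarrow> 's) \<Rightarrow> ennreal" where
  "cond_entropy M NS Y S =
     (THE h. \<exists>K. cond_law M NS Y S K \<and> h = (\<integral>\<^sup>+s. discrete_entropy (K s) \<partial>distr M NS S))"

lemma cond_law_AE_unique:
  fixes Y :: "'o \<Rightarrow> 'b::second_countable_topology"
  assumes M: "prob_space M" and K: "cond_law M NS Y S K" and L: "cond_law M NS Y S L"
  shows "AE s in distr M NS S. K s = L s"
proof -
  let ?D = "distr M NS S"
  have S: "S \<in> M \<rightarrow>\<^sub>M NS" using K by (simp add: cond_law_def)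
  interpret D: prob_space ?D by (rule prob_space.prob_space_distr[OF M S])
  have Km: "K \<in> NS \<rightarrow>\<^sub>M prob_algebra borel" and Lm: "L \<in> NS \<rightarrow>\<^sub>M prob_algebra borel"
    using K L by (auto simp: cond_law_def)
  have meas: "(\<lambda>s. emeasure (J s) B) \<in> borel_measurable NS"
    if "J \<in> NS \<rightarrow>\<^sub>M prob_algebra borel" "B \<in> sets borel" for J and B :: "'b set"
    using measurable_compose[OF measurable_prob_algebraD[OF that(1)]
        measurable_emeasure_subprob_algebra[OF that(2)]] .
  have eqB: "AE s in ?D. emeasure (K s) B = emeasure (L s) B" if B: "B \<in> sets borel" for B
  proof -
    have "density ?D (\<lambda>s. emeasure (K s) B) = density ?D (\<lambda>s. emeasure (L s) B)"
    proof (rule measure_eqI)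
      fix A assume "A \<in> sets (density ?D (\<lambda>s. emeasure (K s) B))"
      then have A: "A \<in> sets NS" by simp
      have "(\<integral>\<^sup>+s\<in>A. emeasure (J s) B \<partial>?D) = emeasure M {w \<in> space M. S w \<in> A \<and> Y w \<in> B}"
        if "cond_law M NS Y S J" for J
        using that A B unfolding cond_law_def by simp
      from this[OF K] this[OF L]
      have "(\<integral>\<^sup>+s\<in>A. emeasure (K s) B \<partial>?D) = (\<integral>\<^sup>+s\<in>A. emeasure (L s) B \<partial>?D)" by simp
      then show "emeasure (density ?D (\<lambda>s. emeasure (K s) B)) A
          = emeasure (density ?D (\<lambda>s. emeasure (L s) B)) A"
        using A meas[OF Km B] meas[OF Lm B] by (simp add: emeasure_density)
    qed simp
    then show ?thesis
      using D.density_unique_iff meas[OF Km B] meas[OF Lm B] by simp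
  qed
  obtain Bs :: "'b set set" where Bs: "countable Bs" "topological_basis Bs"
    using ex_countable_basis by blast
  define E where "E = Inter ` {F. finite F \<and> F \<subseteq> Bs}"
  have cE: "countable E"
    unfolding E_def using countable_Collect_finite_subset[OF Bs(1)]
    by (intro countable_image) (simp add: conj_commute)
  have BsE: "Bs \<subseteq> E" unfolding E_def by (auto intro!: image_eqI[where x="{b}" for b])
  have openE: "open X" if "X \<in> E" for X
    using that topological_basis_open[OF Bs(2)] unfolding E_def by (auto intro!: open_Inter)
  have setsE: "sets (borel :: 'b measure) = sigma_sets UNIV E"
  proof -
    have "sets (borel :: 'b measure) = sigma_sets UNIV Bs"
      unfolding borel_eq_countable_basis[OF Bs] by (rule sets_measure_of) simp
    also have "\<dots> \<subseteq> sigma_sets UNIV E" by (rule sigma_sets_mono') (rule BsE)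
    finally have 1: "sets (borel :: 'b measure) \<subseteq> sigma_sets UNIV E" .
    have "sigma_sets (space borel) E \<subseteq> sets (borel :: 'b measure)"
      by (rule sets.sigma_sets_subset) (auto dest: openE)
    with 1 show ?thesis by auto
  qed
  have intE: "Int_stable E"
  proof (rule Int_stableI)
    fix a b assume "a \<in> E" "b \<in> E"
    then obtain F F' where "a = \<Inter>F" "b = \<Inter>F'" "finite F" "finite F'" "F \<subseteq> Bs" "F' \<subseteq> Bs"
      unfolding E_def by auto
    then show "a \<inter> b \<in> E"
      unfolding E_def by (auto intro!: image_eqI[where x="F \<union> F'"])
  qed
  have UE: "UNIV \<in> E" unfolding E_def by (auto intro!: image_eqI[where x="{}"])
  have "AE s in ?D. \<forall>B\<in>E. emeasure (K s) B = emeasure (L s) B"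
    using cE openE by (subst AE_ball_countable) (auto intro!: eqB)
  moreover have "AE s in ?D. s \<in> space NS" using AE_space[of ?D] by simp
  ultimately show ?thesis
  proof eventually_elim
    case (elim s)
    have Ks: "prob_space (K s)" "sets (K s) = sets borel"
      and Ls: "prob_space (L s)" "sets (L s) = sets borel"
      using measurable_space[OF Km elim(2)] measurable_space[OF Lm elim(2)]
      by (auto simp: space_prob_algebra)
    interpret Ks: prob_space "K s" by fact
    show "K s = L s"
      by (rule measure_eqI_generator_eq[OF intE, where \<Omega>=UNIV and A="\<lambda>_. UNIV"])
         (use elim UE setsE Ks Ls in auto)
  qed
qed

lemma cond_entropy_eq:
  fixes Y :: "'o \<Rightarrow> 'b::second_countable_topology"
  assumes M: "prob_space M" and K: "cond_law M NS Y S K"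
  shows "cond_entropy M NS Y S = (\<integral>\<^sup>+s. discrete_entropy (K s) \<partial>distr M NS S)"
  unfolding cond_entropy_def
proof (rule the_equality)
  fix h assume "\<exists>K. cond_law M NS Y S K \<and> h = (\<integral>\<^sup>+s. discrete_entropy (K s) \<partial>distr M NS S)"
  then obtain L where L: "cond_law M NS Y S L"
    and h: "h = (\<integral>\<^sup>+s. discrete_entropy (L s) \<partial>distr M NS S)" by blast
  show "h = (\<integral>\<^sup>+s. discrete_entropy (K s) \<partial>distr M NS S)"
    unfolding h using cond_law_AE_unique[OF M L K]
    by (intro nn_integral_cong_AE) (auto elim!: eventually_mono)
qed (use K in blast)

lemma cond_law_indep:
  fixes Q :: "'a \<Rightarrow> 's \<Rightarrow> 'b::second_countable_topology"
  assumes MX: "prob_space MX" and NS: "prob_space NS"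
    and Q: "(\<lambda>(x, s). Q x s) \<in> MX \<Otimes>\<^sub>M NS \<rightarrow>\<^sub>M borel"
  shows "cond_law (MX \<Otimes>\<^sub>M NS) NS (\<lambda>(x, s). Q x s) snd (\<lambda>s. distr MX borel (\<lambda>x. Q x s))"
proof -
  interpret X: prob_space MX by fact
  interpret S: prob_space NS by fact
  interpret P: pair_prob_space MX NS ..
  have Qs: "(\<lambda>x. Q x s) \<in> MX \<rightarrow>\<^sub>M borel" if "s \<in> space NS" for s
    using measurable_compose[OF measurable_Pair2'[OF that] Q] by simp
  have D: "distr (MX \<Otimes>\<^sub>M NS) NS snd = NS"
  proof (rule measure_eqI)
    fix A assume "A \<in> sets (distr (MX \<Otimes>\<^sub>M NS) NS snd)"
    then have A: "A \<in> sets NS" by simp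
    have "snd -` A \<inter> space (MX \<Otimes>\<^sub>M NS) = space MX \<times> A"
      using sets.sets_into_space[OF A] by (auto simp: space_pair_measure)
    then show "emeasure (distr (MX \<Otimes>\<^sub>M NS) NS snd) A = emeasure NS A"
      using A by (simp add: emeasure_distr S.emeasure_pair_measure_Times X.emeasure_space_1)
  qed simp
  have kern: "(\<lambda>s. distr MX borel (\<lambda>x. Q x s)) \<in> NS \<rightarrow>\<^sub>M prob_algebra borel"
  proof (rule measurable_prob_algebraI)
    show "prob_space (distr MX borel (\<lambda>x. Q x s))" if "s \<in> space NS" for s
      using X.prob_space_distr[OF Qs[OF that]] .
    have "(\<lambda>(s, x). Q x s) \<in> NS \<Otimes>\<^sub>M MX \<rightarrow>\<^sub>M borel"
      using measurable_compose[OF measurable_pair_swap' Q] by (simp add: case_prod_unfold)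
    moreover have "(\<lambda>_. MX) \<in> NS \<rightarrow>\<^sub>M subprob_algebra MX"
      by (auto intro!: measurable_const simp: space_subprob_algebra X.subprob_space_axioms)
    ultimately show "(\<lambda>s. distr MX borel (\<lambda>x. Q x s)) \<in> NS \<rightarrow>\<^sub>M subprob_algebra borel"
      by (rule measurable_distr2)
  qed
  show ?thesis
    unfolding cond_law_def D
  proof (intro conjI ballI Q kern measurable_snd)
    fix A :: "'s set" and B :: "'b set" assume A: "A \<in> sets NS" and B: "B \<in> sets borel"
    let ?E = "{w \<in> space (MX \<Otimes>\<^sub>M NS). snd w \<in> A \<and> (case w of (x, s) \<Rightarrow> Q x s) \<in> B}"
    have "?E = (snd -` A \<inter> space (MX \<Otimes>\<^sub>M NS)) \<inter> ((\<lambda>(x, s). Q x s) -` B \<inter> space (MX \<Otimes>\<^sub>M NS))"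
      by auto
    also have "\<dots> \<in> sets (MX \<Otimes>\<^sub>M NS)"
      using measurable_sets[OF measurable_snd A] measurable_sets[OF Q B] by blast
    finally have E: "?E \<in> sets (MX \<Otimes>\<^sub>M NS)" .
    have "emeasure (MX \<Otimes>\<^sub>M NS) ?E = (\<integral>\<^sup>+s. emeasure MX ((\<lambda>x. (x, s)) -` ?E) \<partial>NS)"
      by (rule P.emeasure_pair_measure_alt2[OF E])
    also have "\<dots> = (\<integral>\<^sup>+s\<in>A. emeasure (distr MX borel (\<lambda>x. Q x s)) B \<partial>NS)"
    proof (rule nn_integral_cong)
      fix s assume s: "s \<in> space NS"
      have "(\<lambda>x. (x, s)) -` ?E = (if s \<in> A then (\<lambda>x. Q x s) -` B \<inter> space MX else {})"
        using s by (auto simp: space_pair_measure)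
      then show "emeasure MX ((\<lambda>x. (x, s)) -` ?E)
          = emeasure (distr MX borel (\<lambda>x. Q x s)) B * indicator A s"
        using emeasure_distr[OF Qs[OF s] B] by simp
    qed
    finally show "emeasure (MX \<Otimes>\<^sub>M NS) ?E
        = (\<integral>\<^sup>+s\<in>A. emeasure (distr MX borel (\<lambda>x. Q x s)) B \<partial>NS)" .
  qed
qed

(* The product measure makes the input independent of the state. *)
definition normalized_entropy :: "'s measure \<Rightarrow> ('a::euclidean_space \<Rightarrow> 's \<Rightarrow> 'a) \<Rightarrow> ereal" where
  "normalized_entropy NS Q =
     Limsup at_top (\<lambda>\<tau>::real.
       enn2ereal (cond_entropy (uniform_measure lborel (cball 0 \<tau>) \<Otimes>\<^sub>M NS) NS (\<lambda>(x, s). Q x s) snd)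
         - ereal (log 2 (measure lborel (cball (0::'a) \<tau>))))"

end

theory Submission
  imports Defs
begin

text \<open>
  Fix the state $(t, v)$ and put $L = L_t^+(f)$, $b = \beta(t)$. On the inputs in $\tau B^n$ that are
  accepted at the $k$-th dither, the output lies in a translate of $b\,G\,\mathbb{Z}^n$ and, counting
  disjoint translates of $b P$, takes at most $N = \mu((\tau + 2 C b) B^n) / \mu(b P)$ values, where
  $P \subseteq C B^n$. Given $t$, the index $k$ is geometric with success probability
  $p = \mu(L) / \mu(b P)$. Gibbs' inequality against the sub-probability weights
  $y \mapsto \sum_k p (1 - p)^k / N \cdot [y \mbox{ is an output at } k]$ bounds the entropy of the output by the
  expectation of $\log (N / p) + k \log (1 / (1 - p))$, which is affine in $k$ and can therefore be
  averaged over $v$. Since $E[k] = (1 - p) / p$ and $\ln (1 / (1 - p)) \le p / (1 - p)$, the second term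
  contributes at most $\log e$; the first one equals
  $\log \mu(\tau B^n) + n \log (1 + 2 C b / \tau) - \log \mu(L)$.

  Take for $P$ the unit cube and for $\beta(t)$ four times the radius of $L_t^+(f)$, which keeps $p < 1$.
  Writing the supremum in the tail condition as an integral over levels gives
  $\int \beta(t)^n \log (1 + \beta(t)) \, dt < \infty$, so the middle term vanishes in the mean as
  $\tau \to \infty$ by dominated convergence.
\<close>

section \<open>Entropy and cross entropy\<close>

text \<open>Gibbs' inequality: \<open>ln x \<le> x - 1\<close>, summed over the atoms, makes the
  cross entropy against weights of total mass at most 1 an upper bound for the entropy. Where
  \<open>w\<close> is infinite nothing is required of \<open>R\<close>, which accommodates inputs
  whose dithers are all rejected.\<close>

lemma discrete_entropy_le_cross_entropy:
  fixes Y :: "'a \<Rightarrow> 'b::t1_space" and R :: "'b \<Rightarrow> real"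
  assumes M: "prob_space M" and Y: "Y \<in> M \<rightarrow>\<^sub>M borel"
    and R0: "\<And>y. 0 \<le> R y" and R1: "(\<integral>\<^sup>+y. ennreal (R y) \<partial>count_space UNIV) \<le> 1"
    and cR: "countable {y. 0 < R y}" and w: "w \<in> borel_measurable M"
    and Rw: "AE x in M. w x < \<infinity> \<longrightarrow> 0 < R (Y x) \<and> ennreal (- log 2 (R (Y x))) \<le> w x"
  shows "discrete_entropy (distr M borel Y) \<le> (\<integral>\<^sup>+x. w x \<partial>M)"
\<comment> \<open>Only a finite right side needs an argument; then \<open>w\<close> is finite almost
  everywhere, so the conclusion of \<open>Rw\<close> is available almost everywhere.\<close>
proof (cases "(\<integral>\<^sup>+x. w x \<partial>M) < \<infinity>")
  case False
  then show ?thesis by (simp add: not_less top_unique)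
next
  case True
  interpret prob_space M by fact
  let ?N = "distr M borel Y"
  interpret N: prob_space ?N by (rule prob_space_distr[OF Y])
  have fin: "AE x in M. w x < \<infinity>"
    using nn_integral_PInf_AE[OF w] True by (auto simp: top.not_eq_extremum)
  define C where "C = {y. 0 < R y}"
  have C: "countable C" using cR by (simp add: C_def)
  have Csets: "C \<in> sets borel" using C by (auto intro: sets.countable)
  have AEC: "AE x in M. Y x \<in> C"
    using fin Rw by eventually_elim (auto simp: C_def)
  then have "AE y in ?N. y \<in> C"
    using Csets Y by (subst AE_distr_iff) auto
  with C have disc: "discrete_entropy ?N = (\<integral>\<^sup>+y. ennreal (- measure ?N {y} * log 2 (measure ?N {y})) \<partial>count_space UNIV)"
    unfolding discrete_entropy_def by auto
  have m: "ennreal (measure ?N {y}) = (\<integral>\<^sup>+x. indicator {y} (Y x) \<partial>M)" for y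
  proof -
    have "ennreal (measure ?N {y}) = emeasure ?N {y}" by (simp add: N.emeasure_eq_measure)
    also have "\<dots> = (\<integral>\<^sup>+z. indicator {y} z \<partial>?N)" by simp
    also have "\<dots> = (\<integral>\<^sup>+x. indicator {y} (Y x) \<partial>M)"
      using Y by (subst nn_integral_distr) auto
    finally show ?thesis .
  qed
  \<comment> \<open>The law of \<open>Y\<close> lives on the countable set \<open>C\<close>, so a
    sum against its atoms is an expectation; countability also permits the interchange for arbitrary
    \<open>g\<close>.\<close>
  have sum: "(\<integral>\<^sup>+y. g y * ennreal (measure ?N {y}) \<partial>count_space C) = (\<integral>\<^sup>+x. g (Y x) \<partial>M)" for g
  proof -
    have "(\<integral>\<^sup>+y. g y * ennreal (measure ?N {y}) \<partial>count_space C)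
        = (\<integral>\<^sup>+y. (\<integral>\<^sup>+x. g y * indicator {y} (Y x) \<partial>M) \<partial>count_space C)"
      unfolding m using Y by (intro nn_integral_cong nn_integral_cmult[symmetric]) auto
    also have "\<dots> = (\<integral>\<^sup>+x. (\<integral>\<^sup>+y. g y * indicator {y} (Y x) \<partial>count_space C) \<partial>M)"
      using Y by (intro nn_integral_count_space_nn_integral[symmetric] C) auto
    also have "\<dots> = (\<integral>\<^sup>+x. g (Y x) \<partial>M)"
    proof (rule nn_integral_cong_AE, use AEC in eventually_elim)
      fix x assume x: "Y x \<in> C"
      have "(\<integral>\<^sup>+y. g y * indicator {y} (Y x) \<partial>count_space C)
          = (\<integral>\<^sup>+y. g (Y x) * indicator {Y x} y \<partial>count_space C)"
        by (intro nn_integral_cong) (auto simp: indicator_def)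
      also have "\<dots> = g (Y x)" using x by (subst nn_integral_cmult_indicator) auto
      finally show "(\<integral>\<^sup>+y. g y * indicator {y} (Y x) \<partial>count_space C) = g (Y x)" .
    qed
    finally show ?thesis .
  qed
  have zero: "measure ?N {y} = 0" if "y \<notin> C" for y
  proof -
    have "AE x in M. indicator {y} (Y x) = (0::ennreal)"
      using AEC that by (auto elim!: eventually_mono simp: indicator_def)
    then have "ennreal (measure ?N {y}) = 0"
      unfolding m using Y by (subst nn_integral_0_iff_AE) auto
    then show ?thesis by simp
  qed
  have Rle: "R y \<le> 1" for y
  proof -
    have "ennreal (R y) = (\<integral>\<^sup>+z. ennreal (R y) * indicator {y} z \<partial>count_space UNIV)"
      by (subst nn_integral_cmult_indicator) auto
    also have "\<dots> \<le> (\<integral>\<^sup>+z. ennreal (R z) \<partial>count_space UNIV)"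
      by (intro nn_integral_mono) (auto simp: indicator_def)
    finally show ?thesis using R1 by (metis ennreal_le_1 order_trans)
  qed
  \<comment> \<open>\<open>ln x \<le> x - 1\<close> at \<open>x = r / m\<close>. The terms
    \<open>m / ln 2\<close> and \<open>r / ln 2\<close> stay on their own sides; their sums are
    \<open>1 / ln 2\<close> and at most \<open>1 / ln 2\<close>, so a finite constant cancels at the
    end without subtraction in \<open>ennreal\<close>.\<close>
  have gibbs: "- m * log 2 m + m / ln 2 \<le> (- log 2 r) * m + r / ln 2" if "0 \<le> m" "0 < r" for m r :: real
  proof (cases "m = 0")
    case True
    then show ?thesis using that by simp
  next
    case False
    with that have m: "0 < m" by simp
    have "ln (r / m) \<le> r / m - 1" using m that by (intro ln_le_minus_one) auto
    then have "m * (ln r - ln m) \<le> r - m"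
      using m that by (simp add: ln_div field_simps)
    then have "m * (ln r - ln m) / ln 2 \<le> (r - m) / ln 2"
      by (rule divide_right_mono) simp
    then show ?thesis by (simp add: log_def diff_divide_distrib right_diff_distrib algebra_simps)
  qed
  have ent0: "0 \<le> - measure ?N {y} * log 2 (measure ?N {y})" for y
    using N.prob_le_1[of "{y}"] log_le_zero_cancel_iff[of 2 "measure ?N {y}"]
    by (cases "measure ?N {y} = 0") (auto intro!: mult_nonneg_nonpos simp: zero_less_measure_iff)
  have "(\<integral>\<^sup>+y. ennreal (- measure ?N {y} * log 2 (measure ?N {y})) \<partial>count_space UNIV)
      = (\<integral>\<^sup>+y. ennreal (- measure ?N {y} * log 2 (measure ?N {y})) \<partial>count_space C)"
    by (subst (2) nn_integral_count_space_indicator)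
       (auto intro!: nn_integral_cong simp: indicator_def zero)
  also have "\<dots> + ennreal (1 / ln 2) = (\<integral>\<^sup>+y. ennreal (- measure ?N {y} * log 2 (measure ?N {y})
      + measure ?N {y} / ln 2) \<partial>count_space C)"
  proof -
    have "ennreal (1 / ln 2) = (\<integral>\<^sup>+y. ennreal (1 / ln 2) * ennreal (measure ?N {y}) \<partial>count_space C)"
      by (subst sum) (simp add: emeasure_space_1)
    then show ?thesis
      using ent0 by (simp add: nn_integral_add[symmetric] ennreal_plus[symmetric] ennreal_mult[symmetric] del: ennreal_plus)
  qed
  also have "\<dots> \<le> (\<integral>\<^sup>+y. ennreal (- log 2 (R y)) * ennreal (measure ?N {y}) + ennreal (R y) * ennreal (1 / ln 2) \<partial>count_space C)"
  proof (rule nn_integral_mono)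
    fix y assume "y \<in> space (count_space C)"
    then have y: "0 < R y" by (simp add: C_def)
    then have "log 2 (R y) \<le> 0" using Rle[of y] by (subst log_le_zero_cancel_iff) auto
    then show "ennreal (- measure ?N {y} * log 2 (measure ?N {y}) + measure ?N {y} / ln 2)
        \<le> ennreal (- log 2 (R y)) * ennreal (measure ?N {y}) + ennreal (R y) * ennreal (1 / ln 2)"
      using gibbs[OF measure_nonneg y, of ?N "{y}"] y
      by (simp add: ennreal_plus[symmetric] ennreal_mult[symmetric] mult_nonpos_nonneg ennreal_leI del: ennreal_plus)
  qed
  also have "\<dots> = (\<integral>\<^sup>+x. ennreal (- log 2 (R (Y x))) \<partial>M) + (\<integral>\<^sup>+y. ennreal (R y) \<partial>count_space C) * ennreal (1 / ln 2)"
    by (simp add: nn_integral_add nn_integral_multc sum)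
  also have "\<dots> \<le> (\<integral>\<^sup>+x. w x \<partial>M) + 1 * ennreal (1 / ln 2)"
  proof (intro add_mono mult_right_mono)
    show "(\<integral>\<^sup>+x. ennreal (- log 2 (R (Y x))) \<partial>M) \<le> (\<integral>\<^sup>+x. w x \<partial>M)"
      by (rule nn_integral_mono_AE, use fin Rw in eventually_elim) blast
    have "(\<integral>\<^sup>+y. ennreal (R y) \<partial>count_space C) \<le> (\<integral>\<^sup>+y. ennreal (R y) \<partial>count_space UNIV)"
      by (subst nn_integral_count_space_indicator) (auto intro!: nn_integral_mono simp: indicator_def)
    then show "(\<integral>\<^sup>+y. ennreal (R y) \<partial>count_space C) \<le> 1" using R1 by simp
  qed simp
  finally show ?thesis unfolding disc by simp
qed

section \<open>Lattices and basic cells\<close>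

lemma emeasure_lborel_affine_image:
  fixes S :: "'a::euclidean_space set"
  assumes S: "S \<in> sets borel" and b: "b \<noteq> 0"
  shows "(\<lambda>x. b *\<^sub>R x + d) ` S \<in> sets borel"
    and "emeasure lborel ((\<lambda>x. b *\<^sub>R x + d) ` S) = ennreal (\<bar>b\<bar> ^ DIM('a)) * emeasure lborel S"
proof -
  have eq: "(\<lambda>x. b *\<^sub>R x + d) ` S = (\<lambda>y. (1 / b) *\<^sub>R (y - d)) -` S \<inter> space borel"
    using b by (auto intro: image_eqI[where x="(1 / b) *\<^sub>R (y - d)" for y])
  show im: "(\<lambda>x. b *\<^sub>R x + d) ` S \<in> sets borel"
    unfolding eq by (rule measurable_sets[OF _ S]) measurable
  show "emeasure lborel ((\<lambda>x. b *\<^sub>R x + d) ` S) = ennreal (\<bar>b\<bar> ^ DIM('a)) * emeasure lborel S"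
    using emeasure_lebesgue_affine[of b d S] S im by simp
qed

locale lattice_cell =
  fixes G :: "real^'n^'n" and P :: "(real^'n) set"
  assumes basic_cell: "basic_cell G P"
begin

lemma bounded_cell: "bounded P" and cell_sets [measurable]: "P \<in> sets borel"
  using basic_cell by (auto simp: basic_cell_def)

lemma lattice_point_add: "lattice_point G (i + j) = lattice_point G i + lattice_point G j"
proof -
  have "(\<chi> k. real_of_int ((i + j) $ k)) = (\<chi> k. real_of_int (i $ k)) + (\<chi> k. real_of_int (j $ k))"
    by (simp add: vec_eq_iff)
  then show ?thesis by (simp add: lattice_point_def matrix_vector_right_distrib)
qed

lemma lattice_point_minus: "lattice_point G (- j) = - lattice_point G j"
proof -
  have "lattice_point G 0 = 0" using lattice_point_add[of 0 0] by simp
  then have "lattice_point G j + lattice_point G (- j) = 0"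
    using lattice_point_add[of j "- j"] by simp
  then show ?thesis by (metis minus_unique)
qed

lemma ex1_cell: "\<exists>!j. z - lattice_point G j \<in> P"
proof -
  have *: "z \<in> (\<lambda>p. p + lattice_point G j) ` P \<longleftrightarrow> z - lattice_point G j \<in> P" for j
    by (auto intro: image_eqI[where x="z - lattice_point G j"])
  have "z \<in> (\<Union>j. (\<lambda>p. p + lattice_point G j) ` P)"
    using basic_cell by (simp add: basic_cell_def)
  then obtain j where j: "z - lattice_point G j \<in> P" unfolding UN_iff * by blast
  moreover have "i = j" if "z - lattice_point G i \<in> P" for i
  proof (rule ccontr)
    assume "i \<noteq> j"
    then have "(\<lambda>p. p + lattice_point G i) ` P \<inter> (\<lambda>p. p + lattice_point G j) ` P = {}"
      using basic_cell by (auto simp: basic_cell_def disjoint_family_on_def)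
    then show False unfolding disjoint_iff using *[of i] *[of j] j that by metis
  qed
  ultimately show ?thesis by blast
qed

text \<open>Negating the lattice index gives the form that the reflected cell in
  \<open>cell_quantizer\<close> requires.\<close>

lemma ex1_cell_shift: "\<exists>!j. lattice_point G j + x \<in> P"
proof -
  obtain i where i: "x - lattice_point G i \<in> P" "\<And>j. x - lattice_point G j \<in> P \<Longrightarrow> j = i"
    using ex1_cell[of x] by blast
  show ?thesis
  proof (rule ex1I)
    show "lattice_point G (- i) + x \<in> P" using i(1) by (simp add: lattice_point_minus)
    fix j assume "lattice_point G j + x \<in> P"
    then have "- j = i" by (intro i(2)) (simp add: lattice_point_minus add.commute)
    then show "j = - i" by auto
  qed
qed

lemma cell_quantizer_eqI:
  assumes "lattice_point G j - z \<in> P"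
  shows "cell_quantizer G P z = lattice_point G j"
  unfolding cell_quantizer_def
proof (rule the_equality)
  have iff: "z \<in> (\<lambda>p. - p + y) ` P \<longleftrightarrow> y - z \<in> P" for y
  proof
    show "z \<in> (\<lambda>p. - p + y) ` P" if "y - z \<in> P"
      by (rule image_eqI[OF _ that]) simp
  qed auto
  show "lattice_point G j \<in> range (lattice_point G) \<and> z \<in> (\<lambda>p. - p + lattice_point G j) ` P"
    using assms iff by blast
  fix y assume "y \<in> range (lattice_point G) \<and> z \<in> (\<lambda>p. - p + y) ` P"
  then obtain i where y: "y = lattice_point G i" "y - z \<in> P" using iff by blast
  have "lattice_point G i + (- z) \<in> P" "lattice_point G j + (- z) \<in> P"
    using y assms by simp_all
  then have "i = j" using ex1_cell_shift by blast
  then show "y = lattice_point G j" using y by simp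
qed

lemma cell_quantizer_in_lattice: "\<exists>j. cell_quantizer G P z = lattice_point G j"
proof -
  obtain i where "lattice_point G i + (- z) \<in> P" using ex1_cell_shift by blast
  then have "lattice_point G i - z \<in> P" by simp
  then show ?thesis using cell_quantizer_eqI by blast
qed

lemma measurable_cell_quantizer [measurable]: "cell_quantizer G P \<in> borel \<rightarrow>\<^sub>M borel"
proof -
  \<comment> \<open>The quantizer factors through the lattice index \<open>J\<close>, which has
    countably many values; each fibre is a translate of the reflected cell.\<close>
  define J where "J z = (THE j. lattice_point G j - z \<in> P)" for z
  have J: "lattice_point G j - z \<in> P \<longleftrightarrow> J z = j" for j z
  proof -
    have "\<exists>!j. lattice_point G j - z \<in> P" using ex1_cell_shift[of "- z"] by simp
    then show ?thesis unfolding J_def by (metis (mono_tags, lifting) theI')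
  qed
  have "J \<in> borel \<rightarrow>\<^sub>M count_space UNIV"
    unfolding measurable_count_space_eq2_countable
  proof (intro conjI ballI)
    fix j
    have "J -` {j} \<inter> space borel = (\<lambda>z. lattice_point G j - z) -` P \<inter> space borel" using J by auto
    also have "\<dots> \<in> sets borel" by (rule measurable_sets[OF _ cell_sets]) measurable
    finally show "J -` {j} \<inter> space borel \<in> sets borel" .
  qed simp
  then have "(\<lambda>z. lattice_point G (J z)) \<in> borel \<rightarrow>\<^sub>M borel" by measurable
  also have "(\<lambda>z. lattice_point G (J z)) = cell_quantizer G P"
    using J cell_quantizer_eqI by fastforce
  finally show ?thesis .
qed

section \<open>Volume of a basic cell and the law of the dithered error\<close>

lemma emeasure_cell_finite: "emeasure lborel P < \<infinity>"
  by (rule emeasure_bounded_finite[OF bounded_cell])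

text \<open>Countably many translates of a null cell would cover the space by a null set.\<close>

lemma emeasure_cell_pos: "0 < emeasure lborel P"
proof (rule ccontr)
  assume "\<not> ?thesis"
  then have 0: "emeasure lborel P = 0" by simp
  have "(\<lambda>p. p + lattice_point G j) ` P \<in> null_sets lborel" for j
    using emeasure_lborel_affine_image[OF cell_sets, of 1 "lattice_point G j"] 0 by (auto simp: null_sets_def)
  then have "(\<Union>j. (\<lambda>p. p + lattice_point G j) ` P) \<in> null_sets lborel"
    by (intro null_sets_UN') auto
  then have "emeasure lborel (UNIV :: (real^'n) set) = 0"
    using basic_cell by (simp add: basic_cell_def null_sets_def)
  then show False by simp
qed

lemma measure_cell_pos: "0 < measure lborel P"
  and emeasure_cell: "emeasure lborel P = ennreal (measure lborel P)"
  using emeasure_cell_pos emeasure_cell_finite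
  by (auto simp: measure_def enn2real_positive_iff less_top)

lemma prob_space_cell: "prob_space (uniform_measure lborel P)"
  using emeasure_cell_pos emeasure_cell_finite by (intro prob_space_uniform_measure) auto

text \<open>The core of dithering: for \<open>v\<close> uniform on the cell the error is again
  uniform on the cell, whatever \<open>u\<close> is. The set of dithers is split by the lattice
  index, and translating each piece turns this into a splitting of \<open>A\<close>.\<close>

lemma emeasure_cell_error:
  assumes A [measurable]: "A \<in> sets borel" and AP: "A \<subseteq> P"
  shows "emeasure lborel {v \<in> P. cell_quantizer G P (u - v) - (u - v) \<in> A} = emeasure lborel A"
proof -
  \<comment> \<open>Since \<open>A \<subseteq> P\<close>, a lattice point that puts the error in
    \<open>A\<close> is the one that the quantizer chooses.\<close>
  have iff: "cell_quantizer G P z - z \<in> A \<longleftrightarrow> (\<exists>j. lattice_point G j - z \<in> A)" for z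
    using cell_quantizer_in_lattice[of z] cell_quantizer_eqI AP by (metis subsetD)
  have "{v \<in> P. cell_quantizer G P (u - v) - (u - v) \<in> A} = (\<Union>j. {v \<in> P. lattice_point G j - (u - v) \<in> A})"
    unfolding iff by blast
  also have "emeasure lborel \<dots> = (\<integral>\<^sup>+j. emeasure lborel {v \<in> P. lattice_point G j - (u - v) \<in> A} \<partial>count_space UNIV)"
  proof (rule emeasure_UN_countable)
    show "disjoint_family (\<lambda>j. {v \<in> P. lattice_point G j - (u - v) \<in> A})"
      unfolding disjoint_family_on_def
    proof (intro ballI impI)
      fix i j :: "int^'n" assume ij: "i \<noteq> j"
      show "{v \<in> P. lattice_point G i - (u - v) \<in> A} \<inter> {v \<in> P. lattice_point G j - (u - v) \<in> A} = {}"
      proof (rule ccontr)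
        assume "\<not> ?thesis"
        then obtain v where "lattice_point G i - (u - v) \<in> P" "lattice_point G j - (u - v) \<in> P"
          using AP by blast
        then have "lattice_point G i + (v - u) \<in> P" "lattice_point G j + (v - u) \<in> P"
          by (simp_all add: algebra_simps)
        then show False using ex1_cell_shift ij by blast
      qed
    qed
  qed auto
  also have "\<dots> = (\<integral>\<^sup>+j. emeasure lborel {a \<in> A. a + u - lattice_point G j \<in> P} \<partial>count_space UNIV)"
  proof (rule nn_integral_cong)
    fix j
    \<comment> \<open>The translation \<open>a = v + lattice_point G j - u\<close> exchanges the
      constraints: the error condition becomes \<open>a \<in> A\<close>, and
      \<open>v \<in> P\<close> selects the piece of \<open>A\<close>.\<close>
    have "{a \<in> A. a + u - lattice_point G j \<in> P}
        = (\<lambda>v. 1 *\<^sub>R v + (lattice_point G j - u)) ` {v \<in> P. lattice_point G j - (u - v) \<in> A}"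
      by (auto simp: image_iff algebra_simps intro!: exI[where x="a + u - lattice_point G j" for a])
    then show "emeasure lborel {v \<in> P. lattice_point G j - (u - v) \<in> A}
        = emeasure lborel {a \<in> A. a + u - lattice_point G j \<in> P}"
      by (simp only:) (subst emeasure_lborel_affine_image; simp)
  qed
  also have "\<dots> = emeasure lborel (\<Union>j. {a \<in> A. a + u - lattice_point G j \<in> P})"
  proof (rule emeasure_UN_countable[symmetric])
    show "disjoint_family (\<lambda>j. {a \<in> A. a + u - lattice_point G j \<in> P})"
      unfolding disjoint_family_on_def using ex1_cell by blast
  qed auto
  also have "(\<Union>j. {a \<in> A. a + u - lattice_point G j \<in> P}) = A"
    using ex1_cell by blast
  finally show ?thesis .
qed

section \<open>Acceptance probability and number of outputs of the scaled quantizer\<close>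

lemma dithered_quantizer_error:
  assumes "b > 0"
  shows "dithered_quantizer G P b v x - x
    = b *\<^sub>R (cell_quantizer G P (x /\<^sub>R b - v) - (x /\<^sub>R b - v))"
  using assms by (simp add: dithered_quantizer_def algebra_simps)

lemma measurable_dithered_quantizer [measurable (raw)]:
  assumes [measurable]: "b \<in> borel_measurable M" "v \<in> M \<rightarrow>\<^sub>M borel" "x \<in> M \<rightarrow>\<^sub>M borel"
  shows "(\<lambda>w. dithered_quantizer G P (b w) (v w) (x w)) \<in> M \<rightarrow>\<^sub>M borel"
  unfolding dithered_quantizer_def by measurable

text \<open>After division by \<open>b\<close> the target set lies inside \<open>P\<close>, where
  the error is uniform; hence acceptance has the ratio of volumes as its probability, independently
  of \<open>x\<close>.\<close>

lemma emeasure_dither_accept: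
  assumes L [measurable]: "L \<in> sets borel" and b: "b > 0" and LP: "L \<subseteq> (\<lambda>p. b *\<^sub>R p) ` P"
  shows "emeasure (uniform_measure lborel P) {v. dithered_quantizer G P b v x - x \<in> L}
    = ennreal (measure lborel L / (b ^ CARD('n) * measure lborel P))"
proof -
  define A where "A = {a. b *\<^sub>R a \<in> L}"
  have A [measurable]: "A \<in> sets borel" unfolding A_def by measurable
  have AP: "A \<subseteq> P" using LP b by (auto simp: A_def)
  have "L = (\<lambda>a. b *\<^sub>R a + 0) ` A" using LP b by (auto simp: A_def)
  then have LA: "emeasure lborel L = ennreal (b ^ CARD('n)) * emeasure lborel A"
    using emeasure_lborel_affine_image(2)[OF A, of b 0] b by simp
  have Afin: "emeasure lborel A < \<infinity>"
    using emeasure_mono[OF AP, of lborel] emeasure_cell_finite by (auto intro: le_less_trans)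
  have mA: "measure lborel L = b ^ CARD('n) * measure lborel A"
    unfolding measure_def LA using b by (simp add: enn2real_mult)
  have "{v. dithered_quantizer G P b v x - x \<in> L} = {v. cell_quantizer G P (x /\<^sub>R b - v) - (x /\<^sub>R b - v) \<in> A}"
    unfolding dithered_quantizer_error[OF b] A_def by simp
  moreover have "{v. cell_quantizer G P (x /\<^sub>R b - v) - (x /\<^sub>R b - v) \<in> A} \<in> sets borel" by measurable
  ultimately have "emeasure (uniform_measure lborel P) {v. dithered_quantizer G P b v x - x \<in> L}
    = emeasure lborel (P \<inter> {v. cell_quantizer G P (x /\<^sub>R b - v) - (x /\<^sub>R b - v) \<in> A}) / emeasure lborel P"
    by simp
  also have "P \<inter> {v. cell_quantizer G P (x /\<^sub>R b - v) - (x /\<^sub>R b - v) \<in> A}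
    = {v \<in> P. cell_quantizer G P (x /\<^sub>R b - v) - (x /\<^sub>R b - v) \<in> A}" by blast
  also have "emeasure lborel \<dots> = emeasure lborel A" by (rule emeasure_cell_error[OF A AP])
  also have "emeasure lborel A / emeasure lborel P = ennreal (measure lborel A / measure lborel P)"
    using Afin measure_cell_pos
    by (simp add: emeasure_eq_ennreal_measure less_top[symmetric] emeasure_cell divide_ennreal)
  finally show ?thesis using b by (simp add: mA)
qed

text \<open>A packing argument: outputs from one dither differ by points of the scaled lattice, so
  the scaled cells attached to them are disjoint, and all of these fit into the ball. In the radius,
  one \<open>C * b\<close> pays for the quantization error and the other for the cell
  itself.\<close>

lemma card_outputs_le:
  assumes b: "b > 0" and LP: "L \<subseteq> (\<lambda>p. b *\<^sub>R p) ` P" and C: "P \<subseteq> cball 0 C" and \<tau>: "\<tau> \<ge> 0"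
    and S: "S = {y \<in> range (\<lambda>j. b *\<^sub>R (lattice_point G j + u)). \<exists>x\<in>cball 0 \<tau>. y - x \<in> L}"
  shows "finite S \<and> real (card S) * (b ^ CARD('n) * measure lborel P)
      \<le> measure lborel (cball (0::real^'n) (\<tau> + 2 * C * b))"
proof -
  define T where "T y = (\<lambda>p. b *\<^sub>R p + y) ` P" for y
  have Tm: "T y \<in> sets borel" and Te: "emeasure lborel (T y) = ennreal (b ^ CARD('n) * measure lborel P)" for y
    using emeasure_lborel_affine_image[OF cell_sets, of b y] b unfolding T_def
    by (auto simp: emeasure_cell ennreal_mult)
  let ?B = "cball (0::real^'n) (\<tau> + 2 * C * b)"
  have TB: "T y \<subseteq> ?B" if y: "y \<in> S" for y
  proof
    fix z assume "z \<in> T y"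
    then obtain p where p: "p \<in> P" "z = b *\<^sub>R p + y" by (auto simp: T_def)
    from y obtain x q where x: "norm x \<le> \<tau>" "q \<in> P" "y - x = b *\<^sub>R q" using LP S by auto
    have "z = b *\<^sub>R p + (x + b *\<^sub>R q)" using p x by (simp add: algebra_simps)
    then have "norm z \<le> norm (b *\<^sub>R p) + (norm x + norm (b *\<^sub>R q))"
      by (metis norm_triangle_mono order_refl)
    also have "\<dots> \<le> b * C + (\<tau> + b * C)"
      using p x C b by (intro add_mono) (auto intro!: mult_left_mono)
    finally show "z \<in> ?B" by (simp add: algebra_simps)
  qed
  have disj: "T y \<inter> T y' = {}" if ys: "y \<in> S" "y' \<in> S" "y \<noteq> y'" for y y'
  proof (rule ccontr)
    assume "T y \<inter> T y' \<noteq> {}"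
    then obtain p p' where p: "p \<in> P" "p' \<in> P" "b *\<^sub>R p + y = b *\<^sub>R p' + y'" by (auto simp: T_def)
    obtain j j' where j: "y = b *\<^sub>R (lattice_point G j + u)" "y' = b *\<^sub>R (lattice_point G j' + u)"
      using ys S by auto
    have "b *\<^sub>R (p + lattice_point G j) = b *\<^sub>R (p' + lattice_point G j')"
      using p(3) unfolding j by (simp add: algebra_simps)
    then have "p + lattice_point G j = p' + lattice_point G j'" using b by simp
    then have "(p + lattice_point G j) - lattice_point G j' \<in> P"
      using p by simp
    moreover have "(p + lattice_point G j) - lattice_point G j \<in> P" using p(1) by simp
    ultimately have "j = j'" using ex1_cell by blast
    then show False using ys j by simp
  qed
  have Bfin: "emeasure lborel ?B = ennreal (measure lborel ?B)"
    by (rule emeasure_eq_ennreal_measure) (use emeasure_bounded_finite[of ?B] in \<open>auto simp: less_top\<close>)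
  have bd: "real (card F) * (b ^ CARD('n) * measure lborel P) \<le> measure lborel ?B"
    if F: "F \<subseteq> S" "finite F" for F
  proof -
    have "ennreal (real (card F) * (b ^ CARD('n) * measure lborel P)) = (\<Sum>y\<in>F. emeasure lborel (T y))"
      using b measure_cell_pos by (simp add: Te ennreal_of_nat_eq_real_of_nat ennreal_mult')
    also have "\<dots> = emeasure lborel (\<Union>y\<in>F. T y)"
      using F Tm disj by (intro sum_emeasure) (auto simp: disjoint_family_on_def, blast)
    also have "\<dots> \<le> emeasure lborel ?B"
      using TB F by (intro emeasure_mono) auto
    finally show ?thesis unfolding Bfin by (subst (asm) ennreal_le_iff) auto
  qed
  have c: "0 < b ^ CARD('n) * measure lborel P" using b measure_cell_pos by simp
  have "finite S"
  proof (rule finite_if_finite_subsets_card_bdd[where C="nat \<lceil>measure lborel ?B / (b ^ CARD('n) * measure lborel P)\<rceil>", THEN conjunct1])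
    fix F assume "F \<subseteq> S" "finite F"
    from bd[OF this] c have "real (card F) \<le> measure lborel ?B / (b ^ CARD('n) * measure lborel P)"
      by (simp add: pos_le_divide_eq)
    then show "card F \<le> nat \<lceil>measure lborel ?B / (b ^ CARD('n) * measure lborel P)\<rceil>"
      by linarith
  qed
  then show ?thesis using bd[of S] by simp
qed

end

section \<open>Rejection sampling with a fixed superlevel set\<close>

lemma measurable_Least_compose:
  assumes "\<And>i::nat. Measurable.pred M (A i)" "\<And>i. h i \<in> M \<rightarrow>\<^sub>M N"
  shows "(\<lambda>x. h (LEAST i. A i x) x) \<in> M \<rightarrow>\<^sub>M N"
proof (rule measurable_compose_countable)
  show "(\<lambda>x. LEAST i. A i x) \<in> M \<rightarrow>\<^sub>M count_space UNIV"
    by (rule measurable_Least) (rule assms(1))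
qed (rule assms(2))

text \<open>\<open>ln z \<le> z - 1\<close> at \<open>z = 1 / (1 - p)\<close> gives
  \<open>p / (1 - p)\<close>, the reciprocal of the mean number of rejections.\<close>

lemma geometric_entropy_bound:
  fixes p :: real
  assumes "0 < p" "p < 1"
  shows "log 2 (1 / (1 - p)) * ((1 - p) / p) \<le> log 2 (exp 1)"
proof -
  have "ln (1 / (1 - p)) \<le> 1 / (1 - p) - 1" using assms by (intro ln_le_minus_one) auto
  also have "\<dots> = p / (1 - p)" using assms by (simp add: field_simps)
  finally have "ln (1 / (1 - p)) * ((1 - p) / p) \<le> p / (1 - p) * ((1 - p) / p)"
    using assms by (intro mult_right_mono) auto
  then have "ln (1 / (1 - p)) * ((1 - p) / p) \<le> 1" using assms by simp
  then have "ln (1 / (1 - p)) * ((1 - p) / p) / ln 2 \<le> 1 / ln 2"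
    by (rule divide_right_mono) simp
  then show ?thesis by (simp add: log_def mult.commute)
qed

context lattice_cell
begin

definition rejection_quantizer ::
    "(real^'n) set \<Rightarrow> real \<Rightarrow> (nat \<Rightarrow> real^'n) \<Rightarrow> real^'n \<Rightarrow> real^'n" where
  "rejection_quantizer L b v x =
     dithered_quantizer G P b (v (LEAST i. dithered_quantizer G P b (v i) x - x \<in> L)) x"

text \<open>The number of dithers rejected before the first acceptance, infinite if there is none; unlike
  the \<open>LEAST\<close> index it is a sum of indicators of cylinder sets.\<close>

definition rejections ::
    "(real^'n) set \<Rightarrow> real \<Rightarrow> (nat \<Rightarrow> real^'n) \<Rightarrow> real^'n \<Rightarrow> ennreal" where
  "rejections L b v x =
     (\<Sum>k. indicator {v. \<forall>i\<le>k. dithered_quantizer G P b (v i) x - x \<notin> L} v)"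

abbreviation "dithers \<equiv> (\<Pi>\<^sub>M i\<in>(UNIV::nat set). uniform_measure lborel P)"

lemma lrsuq_eq: "lrsuq f G P \<beta> x (t, v) = rejection_quantizer (superlevel f t) (\<beta> t) v x"
  by (simp add: lrsuq_def rejection_quantizer_def)

lemma measurable_rejection_quantizer:
  assumes [measurable]: "L \<in> sets borel"
  shows "rejection_quantizer L b v \<in> borel \<rightarrow>\<^sub>M borel"
  unfolding rejection_quantizer_def
  by (rule measurable_Least_compose[where h="\<lambda>i x. dithered_quantizer G P b (v i) x"
      and A="\<lambda>i x. dithered_quantizer G P b (v i) x - x \<in> L"]) measurable

lemma measurable_lrsuq:
  assumes [measurable]: "f \<in> borel_measurable borel" "\<beta> \<in> borel_measurable borel"
  shows "(\<lambda>(x, s). lrsuq f G P \<beta> x s) \<in> borel \<Otimes>\<^sub>M (borel \<Otimes>\<^sub>M dithers) \<rightarrow>\<^sub>M borel"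
proof -
  define h where "h i w = dithered_quantizer G P (\<beta> (fst (snd w))) (snd (snd w) i) (fst w)"
    for i :: nat and w :: "(real^'n) \<times> real \<times> (nat \<Rightarrow> real^'n)"
  have h [measurable]: "h i \<in> borel \<Otimes>\<^sub>M (borel \<Otimes>\<^sub>M dithers) \<rightarrow>\<^sub>M borel" for i
    unfolding h_def by measurable
  \<comment> \<open>Membership in the superlevel set is written as an inequality for
    \<open>f\<close>, which is measurable jointly in the level and the point.\<close>
  have "(\<lambda>w. h (LEAST i. f (h i w - fst w) \<ge> fst (snd w)) w) \<in> borel \<Otimes>\<^sub>M (borel \<Otimes>\<^sub>M dithers) \<rightarrow>\<^sub>M borel"
    by (rule measurable_Least_compose[where A="\<lambda>i w. f (h i w - fst w) \<ge> fst (snd w)"]) measurable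
  also have "(\<lambda>w. h (LEAST i. f (h i w - fst w) \<ge> fst (snd w)) w) = (\<lambda>(x, s). lrsuq f G P \<beta> x s)"
    by (simp add: lrsuq_def superlevel_def case_prod_beta Let_def h_def fun_eq_iff)
  finally show ?thesis .
qed

lemma measurable_rejections:
  assumes [measurable]: "f \<in> borel_measurable borel" "\<beta> \<in> borel_measurable borel"
  shows "(\<lambda>(t, v, x). rejections (superlevel f t) (\<beta> t) v x) \<in> borel_measurable (borel \<Otimes>\<^sub>M dithers \<Otimes>\<^sub>M borel)"
proof -
  define e where "e i w = dithered_quantizer G P (\<beta> (fst w)) (fst (snd w) i) (snd (snd w)) - snd (snd w)"
    for i :: nat and w :: "real \<times> (nat \<Rightarrow> real^'n) \<times> (real^'n)"
  have e [measurable]: "e i \<in> borel \<Otimes>\<^sub>M dithers \<Otimes>\<^sub>M borel \<rightarrow>\<^sub>M borel" for i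
    unfolding e_def by measurable
  have "(\<lambda>w. \<Sum>k. (if \<forall>i\<in>{..k}. f (e i w) < fst w then 1 else 0) :: ennreal)
     \<in> borel_measurable (borel \<Otimes>\<^sub>M dithers \<Otimes>\<^sub>M borel)"
    by measurable
  also have "(\<lambda>w. \<Sum>k. (if \<forall>i\<in>{..k}. f (e i w) < fst w then 1 else 0) :: ennreal)
      = (\<lambda>(t, v, x). rejections (superlevel f t) (\<beta> t) v x)"
    by (auto simp: rejections_def superlevel_def indicator_def not_le e_def fun_eq_iff intro!: suminf_cong)
  finally show ?thesis .
qed

text \<open>The indicator for \<open>k\<close> is 1 exactly when dithers 0 to \<open>k\<close> all
  fail. If the first success has index \<open>k\<close>, precisely the \<open>k\<close> earlier
  indicators are 1; without a success all of them are, and the series diverges.\<close>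

lemma rejections_cases:
  obtains (never) "rejections L b v x = \<infinity>"
  | (accept) k where "dithered_quantizer G P b (v k) x - x \<in> L"
      "(LEAST i. dithered_quantizer G P b (v i) x - x \<in> L) = k" "rejections L b v x = of_nat k"
proof (cases "\<exists>k. dithered_quantizer G P b (v k) x - x \<in> L")
  case False
  then have "rejections L b v x = (\<Sum>k::nat. 1)" unfolding rejections_def by simp
  also have "\<dots> = \<infinity>"
    using summable_suminf_not_top[of "\<lambda>_. 1"] by (auto simp: summable_const_iff)
  finally show ?thesis by (rule never)
next
  case True
  define k where "k = (LEAST i. dithered_quantizer G P b (v i) x - x \<in> L)"
  have k: "dithered_quantizer G P b (v k) x - x \<in> L"
    unfolding k_def using True by (rule LeastI_ex)
  have less: "dithered_quantizer G P b (v i) x - x \<notin> L" if "i < k" for i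
    using not_less_Least that unfolding k_def by blast
  have "rejections L b v x = (\<Sum>j\<in>{..<k}. indicator {v. \<forall>i\<le>j. dithered_quantizer G P b (v i) x - x \<notin> L} v)"
    unfolding rejections_def
  proof (rule suminf_finite)
    fix j assume "j \<notin> {..<k}"
    then have "k \<le> j" by simp
    then show "indicator {v. \<forall>i\<le>j. dithered_quantizer G P b (v i) x - x \<notin> L} v = (0::ennreal)"
      using k by (auto simp: indicator_def)
  qed simp
  also have "\<dots> = (\<Sum>j\<in>{..<k}. 1)"
    using less by (intro sum.cong) (auto simp: indicator_def)
  finally show ?thesis using accept k k_def by simp
qed

end

section \<open>Input uniform on a ball: mean number of rejections and entropy of the output\<close>

lemma prob_space_uniform_cball:
  "\<tau> > 0 \<Longrightarrow> prob_space (uniform_measure lborel (cball (0::'a::euclidean_space) \<tau>))"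
  using emeasure_bounded_finite[of "cball (0::'a) \<tau>"] content_cball_gt_0_iff[of "0::'a" \<tau>]
  by (intro prob_space_uniform_measure) (auto simp: measure_def enn2real_positive_iff)

context lattice_cell
begin

text \<open>\<open>L\<close> is the superlevel set of its own indicator at level 1, which reduces
  the claim to the version for functions.\<close>

lemma measurable_rejections_set:
  assumes [measurable]: "L \<in> sets borel"
  shows "(\<lambda>(v, x). rejections L b v x) \<in> borel_measurable (dithers \<Otimes>\<^sub>M borel)"
proof -
  have "(\<lambda>w. (1::real, fst w, snd w)) \<in> dithers \<Otimes>\<^sub>M borel \<rightarrow>\<^sub>M borel \<Otimes>\<^sub>M dithers \<Otimes>\<^sub>M (borel :: (real^'n) measure)"
    by measurable
  from measurable_compose[OF this measurable_rejections[of "indicator L" "\<lambda>_. b"]]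
  moreover have "superlevel (indicator L) 1 = L" by (auto simp: superlevel_def indicator_def)
  ultimately show ?thesis by (simp add: case_prod_beta)
qed

text \<open>The tail-sum formula for the mean of a geometric variable: the event for
  \<open>k\<close> involves the \<open>Suc k\<close> independent dithers with index at most
  \<open>k\<close>, whence the exponent in the series.\<close>

lemma nn_integral_rejections:
  fixes p :: real
  assumes L [measurable]: "L \<in> sets borel" and b: "b > 0" and LP: "L \<subseteq> (\<lambda>p. b *\<^sub>R p) ` P"
    and p: "p = measure lborel L / (b ^ CARD('n) * measure lborel P)" "0 < p" "p < 1"
  shows "(\<integral>\<^sup>+v. rejections L b v x \<partial>dithers) = ennreal ((1 - p) / p)"
proof -
  interpret U: prob_space "uniform_measure lborel P" by (rule prob_space_cell)
  interpret D: product_prob_space "\<lambda>_::nat. uniform_measure lborel P" UNIV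
    by unfold_locales
  define R where "R = {v. dithered_quantizer G P b v x - x \<notin> L}"
  have Acc: "{v. dithered_quantizer G P b v x - x \<in> L} \<in> sets borel" by measurable
  have R [measurable]: "R \<in> sets borel" unfolding R_def by measurable
  have "measure (uniform_measure lborel P) R = 1 - p"
  proof -
    have "R = space (uniform_measure lborel P) - {v. dithered_quantizer G P b v x - x \<in> L}"
      by (auto simp: R_def)
    then have "measure (uniform_measure lborel P) R
        = 1 - measure (uniform_measure lborel P) {v. dithered_quantizer G P b v x - x \<in> L}"
      using Acc by (simp only:) (rule U.prob_compl, simp)
    also have "measure (uniform_measure lborel P) {v. dithered_quantizer G P b v x - x \<in> L} = p"
      by (rule measure_eq_emeasure_eq_ennreal) (use p emeasure_dither_accept[OF L b LP] in auto)
    finally show ?thesis .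
  qed
  then have eR: "emeasure (uniform_measure lborel P) R = ennreal (1 - p)"
    by (simp add: U.emeasure_eq_measure)
  have meas: "{v \<in> space dithers. \<forall>i\<in>{..k}. v i \<in> R} \<in> sets dithers" for k
    by measurable
  have "(\<integral>\<^sup>+v. rejections L b v x \<partial>dithers)
      = (\<integral>\<^sup>+v. (\<Sum>k. indicator {v \<in> space dithers. \<forall>i\<in>{..k}. v i \<in> R} v) \<partial>dithers)"
    by (intro nn_integral_cong) (auto simp: rejections_def R_def indicator_def space_PiM intro!: suminf_cong)
  also have "\<dots> = (\<Sum>k. \<integral>\<^sup>+v. indicator {v \<in> space dithers. \<forall>i\<in>{..k}. v i \<in> R} v \<partial>dithers)"
    by (rule nn_integral_suminf) (use meas in auto)
  also have "\<dots> = (\<Sum>k. ennreal ((1 - p) ^ Suc k))"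
  proof (rule suminf_cong)
    fix k
    have "(\<integral>\<^sup>+v. indicator {v \<in> space dithers. \<forall>i\<in>{..k}. v i \<in> R} v \<partial>dithers)
        = emeasure dithers {v \<in> space dithers. \<forall>i\<in>{..k}. v i \<in> R}"
      by (rule nn_integral_indicator) (rule meas)
    also have "\<dots> = (\<Prod>i\<in>{..k}. emeasure (uniform_measure lborel P) R)"
      by (rule D.emeasure_PiM_Collect) auto
    also have "\<dots> = ennreal ((1 - p) ^ Suc k)"
      using p(2,3) by (simp only: eR prod_constant card_atMost) (simp only: ennreal_power)
    finally show "(\<integral>\<^sup>+v. indicator {v \<in> space dithers. \<forall>i\<in>{..k}. v i \<in> R} v \<partial>dithers) = ennreal ((1 - p) ^ Suc k)" .
  qed
  also have "\<dots> = ennreal ((1 - p) / p)"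
  proof (rule suminf_ennreal_eq)
    have "(\<lambda>k. (1 - p) * (1 - p) ^ k) sums ((1 - p) * (1 / (1 - (1 - p))))"
      by (intro sums_mult geometric_sums) (use p(2,3) in auto)
    then show "(\<lambda>k. (1 - p) ^ Suc k) sums ((1 - p) / p)" by simp
  qed (use p(2,3) in simp)
  finally show ?thesis .
qed

text \<open>Gibbs' inequality is applied for each fixed dither sequence; the resulting bound is
  affine in \<open>rejections\<close>, so the later average over \<open>v\<close> needs only their
  mean.\<close>

lemma entropy_rejection_quantizer_le:
  fixes p :: real
  assumes L [measurable]: "L \<in> sets borel" and b: "b > 0" and LP: "L \<subseteq> (\<lambda>p. b *\<^sub>R p) ` P"
    and C: "P \<subseteq> cball 0 C" and \<tau>: "\<tau> > 0"
    and p: "p = measure lborel L / (b ^ CARD('n) * measure lborel P)" "0 < p" "p < 1"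
  shows "discrete_entropy (distr (uniform_measure lborel (cball 0 \<tau>)) borel (rejection_quantizer L b v))
    \<le> (\<integral>\<^sup>+x. ennreal (log 2 (measure lborel (cball (0::real^'n) (\<tau> + 2 * C * b)) / measure lborel L))
        + ennreal (log 2 (1 / (1 - p))) * rejections L b v x \<partial>uniform_measure lborel (cball 0 \<tau>))"
proof -
  let ?U = "uniform_measure lborel (cball (0::real^'n) \<tau>)"
  interpret U: prob_space ?U by (rule prob_space_uniform_cball[OF \<tau>])
  \<comment> \<open>\<open>S k\<close> collects the possible outputs when dither \<open>k\<close> is
    accepted, \<open>N\<close> bounds their number by the packing argument, and \<open>B\<close> is
    the volume of the enlarged ball.\<close>
  define B where "B = measure lborel (cball (0::real^'n) (\<tau> + 2 * C * b))"
  define N where "N = B / (b ^ CARD('n) * measure lborel P)"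
  define S where "S k = {y \<in> range (\<lambda>j. b *\<^sub>R (lattice_point G j + v k)). \<exists>x\<in>cball 0 \<tau>. y - x \<in> L}" for k
  have c: "0 < b ^ CARD('n) * measure lborel P" using b measure_cell_pos by simp
  have C0: "0 \<le> C"
  proof -
    obtain q where "q \<in> P" using measure_cell_pos by (cases "P = {}") auto
    then have "norm q \<le> C" using C by auto
    then show ?thesis using norm_ge_zero[of q] by linarith
  qed
  have B: "0 < B" unfolding B_def using \<tau> C0 b by (subst content_cball_gt_0_iff) (auto intro: add_pos_nonneg)
  have N: "0 < N" unfolding N_def using B c by simp
  have mL: "0 < measure lborel L" using p(1,2) c by (simp add: zero_less_divide_iff)
  have NL: "N / p = B / measure lborel L" unfolding N_def p(1) using c b measure_cell_pos by simp
  have S: "finite (S k)" "real (card (S k)) \<le> N" for k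
  proof -
    from card_outputs_le[OF b LP C _ S_def] \<tau> c
    show "finite (S k)" "real (card (S k)) \<le> N" by (auto simp: N_def B_def pos_le_divide_eq)
  qed
  \<comment> \<open>Geometric mass \<open>p * (1 - p) ^ k\<close> is spread over \<open>S k\<close>.
    The divisor is the bound \<open>N\<close> rather than the cardinality, so the weights do not
    depend on the size of \<open>S k\<close> and their total is at most 1.\<close>
  define r where "r k y = p * (1 - p) ^ k / N * indicator (S k) y" for k y
  have r0: "0 \<le> r k y" for k y using p(2,3) N by (simp add: r_def)
  have geo: "(\<lambda>k. p * (1 - p) ^ k) sums 1"
    using sums_mult[OF geometric_sums[of "1 - p"], of p] p(2,3) by simp
  have rsum: "summable (\<lambda>k. r k y)" for y
  proof (rule summable_comparison_test)
    show "\<exists>n0. \<forall>n\<ge>n0. norm (r n y) \<le> p * (1 - p) ^ n / N"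
      using p(2,3) N by (auto simp: r_def indicator_def)
    show "summable (\<lambda>n. p * (1 - p) ^ n / N)" using geo by (intro summable_divide) (rule sums_summable)
  qed
  define R where "R y = (\<Sum>k. r k y)" for y
  have Rr: "r k y \<le> R y" for k y
    using sum_le_suminf[OF rsum, of "{k}"] r0 by (simp add: R_def)
  have Y: "rejection_quantizer L b v \<in> ?U \<rightarrow>\<^sub>M borel"
    using measurable_rejection_quantizer[OF L] by simp
  show ?thesis
    unfolding B_def[symmetric]
  proof (rule discrete_entropy_le_cross_entropy[OF U.prob_space_axioms Y, where R=R])
    show "0 \<le> R y" for y unfolding R_def by (rule suminf_nonneg[OF rsum r0])
    have "(\<integral>\<^sup>+y. ennreal (R y) \<partial>count_space UNIV) = (\<integral>\<^sup>+y. (\<Sum>k. ennreal (r k y)) \<partial>count_space UNIV)"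
      unfolding R_def using r0 rsum by (intro nn_integral_cong) (simp add: suminf_ennreal2)
    also have "\<dots> = (\<Sum>k. \<integral>\<^sup>+y. ennreal (r k y) \<partial>count_space UNIV)"
      by (rule nn_integral_suminf) simp
    also have "\<dots> \<le> (\<Sum>k. ennreal (p * (1 - p) ^ k))"
    proof (rule suminf_le)
      fix k
      have "(\<integral>\<^sup>+y. ennreal (r k y) \<partial>count_space UNIV)
          = (\<integral>\<^sup>+y. ennreal (p * (1 - p) ^ k / N) * indicator (S k) y \<partial>count_space UNIV)"
        by (intro nn_integral_cong) (auto simp: r_def indicator_def)
      also have "\<dots> = ennreal (p * (1 - p) ^ k / N) * ennreal (real (card (S k)))"
        using S by (subst nn_integral_cmult_indicator) (auto simp: ennreal_of_nat_eq_real_of_nat)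
      also have "\<dots> = ennreal (p * (1 - p) ^ k * (real (card (S k)) / N))"
        using p(2,3) N by (subst ennreal_mult[symmetric]) auto
      also have "\<dots> \<le> ennreal (p * (1 - p) ^ k * 1)"
        using S(2)[of k] N p(2,3) by (intro ennreal_leI mult_left_mono) auto
      finally show "(\<integral>\<^sup>+y. ennreal (r k y) \<partial>count_space UNIV) \<le> ennreal (p * (1 - p) ^ k)" by simp
    qed auto
    also have "(\<Sum>k. ennreal (p * (1 - p) ^ k)) = ennreal 1"
      by (rule suminf_ennreal_eq[OF _ geo]) (use p(2,3) in simp)
    finally show "(\<integral>\<^sup>+y. ennreal (R y) \<partial>count_space UNIV) \<le> 1" by simp
    have "{y. 0 < R y} \<subseteq> (\<Union>k. S k)"
    proof (rule subsetI, rule ccontr)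
      fix y assume y: "y \<in> {y. 0 < R y}" "y \<notin> (\<Union>k. S k)"
      then have "R y = 0" by (simp add: R_def r_def)
      then show False using y by simp
    qed
    moreover have "countable (\<Union>k. S k)" using S by (intro countable_UN) (auto intro: countable_finite)
    ultimately show "countable {y. 0 < R y}" by (rule countable_subset)
    have "(\<lambda>x. rejections L b v x) \<in> borel_measurable borel"
    proof -
      have "Pair v \<in> borel \<rightarrow>\<^sub>M dithers \<Otimes>\<^sub>M borel"
        by (rule measurable_Pair1') (simp add: space_PiM)
      from measurable_compose[OF this measurable_rejections_set[OF L]] show ?thesis by simp
    qed
    then show "(\<lambda>x. ennreal (log 2 (B / measure lborel L)) + ennreal (log 2 (1 / (1 - p))) * rejections L b v x)
        \<in> borel_measurable ?U" by simp
    \<comment> \<open>Strict positivity matters: endless rejection then makes the bound infinite, so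
      the premise of the implication excludes such inputs.\<close>
    have l0: "0 < log 2 (1 / (1 - p))" using p(2,3) by (subst zero_less_log_cancel_iff) auto
    show "AE x in ?U. ennreal (log 2 (B / measure lborel L)) + ennreal (log 2 (1 / (1 - p))) * rejections L b v x < \<infinity>
        \<longrightarrow> 0 < R (rejection_quantizer L b v x) \<and> ennreal (- log 2 (R (rejection_quantizer L b v x)))
          \<le> ennreal (log 2 (B / measure lborel L)) + ennreal (log 2 (1 / (1 - p))) * rejections L b v x"
    proof (rule AE_uniform_measureI; (intro AE_I2 impI)?)
      fix x :: "real^'n"
      assume x: "x \<in> cball 0 \<tau>"
        and fin: "ennreal (log 2 (B / measure lborel L)) + ennreal (log 2 (1 / (1 - p))) * rejections L b v x < \<infinity>"
      show "0 < R (rejection_quantizer L b v x) \<and> ennreal (- log 2 (R (rejection_quantizer L b v x)))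
          \<le> ennreal (log 2 (B / measure lborel L)) + ennreal (log 2 (1 / (1 - p))) * rejections L b v x"
      proof (cases rule: rejections_cases[of L b v x])
        case never
        then show ?thesis using fin l0 by (simp add: ennreal_mult_top)
      next
        case (accept k)
        define y where "y = dithered_quantizer G P b (v k) x"
        have yeq: "rejection_quantizer L b v x = y" unfolding rejection_quantizer_def accept(2) y_def ..
        obtain j where "cell_quantizer G P (x /\<^sub>R b - v k) = lattice_point G j"
          using cell_quantizer_in_lattice by blast
        then have "y = b *\<^sub>R (lattice_point G j + v k)" by (simp add: y_def dithered_quantizer_def)
        then have "y \<in> S k" using x accept(1) unfolding S_def y_def[symmetric] by blast
        \<comment> \<open>The terms of \<open>R\<close> are nonnegative, so the \<open>k\<close>-th
          one alone bounds \<open>R y\<close> from below.\<close>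
        then have Ry: "p * (1 - p) ^ k / N \<le> R y" using Rr[of k y] by (simp add: r_def)
        have pos: "0 < p * (1 - p) ^ k / N" using p(2,3) N by simp
        have "- log 2 (R y) \<le> - log 2 (p * (1 - p) ^ k / N)"
          using Ry pos by simp
        also have "\<dots> = log 2 (B / measure lborel L) + real k * log 2 (1 / (1 - p))"
          unfolding NL[symmetric] using p(2,3) N by (simp add: log_divide log_mult log_nat_power)
        finally have "ennreal (- log 2 (R y)) \<le> ennreal (log 2 (B / measure lborel L) + real k * log 2 (1 / (1 - p)))"
          by (rule ennreal_leI)
        \<comment> \<open>The first logarithm is not assumed nonnegative here; truncating it to zero
          only enlarges the bound.\<close>
        also have "\<dots> \<le> ennreal (log 2 (B / measure lborel L)) + ennreal (real k * log 2 (1 / (1 - p)))"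
          using l0 by (cases "0 \<le> log 2 (B / measure lborel L)") (auto simp: ennreal_neg intro!: ennreal_leI)
        also have "ennreal (real k * log 2 (1 / (1 - p))) = ennreal (log 2 (1 / (1 - p))) * of_nat k"
          using l0 by (simp add: ennreal_mult ennreal_of_nat_eq_real_of_nat mult.commute)
        finally show ?thesis using Ry pos unfolding yeq accept(3) by simp
      qed
    qed simp
  qed
qed

text \<open>Tonelli's theorem puts the average over the dithers inside. For each input it replaces
  \<open>rejections\<close> by its mean, and \<open>geometric_entropy_bound\<close> does the
  rest.\<close>

lemma nn_integral_entropy_bound_le:
  fixes p :: real
  assumes L [measurable]: "L \<in> sets borel" and b: "b > 0" and LP: "L \<subseteq> (\<lambda>p. b *\<^sub>R p) ` P"
    and \<tau>: "\<tau> > 0"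
    and p: "p = measure lborel L / (b ^ CARD('n) * measure lborel P)" "0 < p" "p < 1"
  shows "(\<integral>\<^sup>+v. (\<integral>\<^sup>+x. a + ennreal (log 2 (1 / (1 - p))) * rejections L b v x
        \<partial>uniform_measure lborel (cball 0 \<tau>)) \<partial>dithers) \<le> a + ennreal (log 2 (exp 1))"
proof -
  let ?U = "uniform_measure lborel (cball (0::real^'n) \<tau>)"
  interpret U: prob_space ?U by (rule prob_space_uniform_cball[OF \<tau>])
  interpret UP: prob_space "uniform_measure lborel P" by (rule prob_space_cell)
  interpret D: product_prob_space "\<lambda>_::nat. uniform_measure lborel P" UNIV
    by unfold_locales
  have D1: "prob_space dithers" by (rule D.prob_space_axioms)
  interpret DU: pair_prob_space ?U dithers
    by (intro pair_prob_space.intro pair_sigma_finite.intro prob_space_imp_sigma_finite U.prob_space_axioms D1)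
  have sw: "(\<lambda>w. (snd w, fst w)) \<in> ?U \<Otimes>\<^sub>M dithers \<rightarrow>\<^sub>M dithers \<Otimes>\<^sub>M borel"
    by measurable
  have m [measurable]: "(\<lambda>w. rejections L b (snd w) (fst w)) \<in> borel_measurable (?U \<Otimes>\<^sub>M dithers)"
    using measurable_compose[OF sw measurable_rejections_set[OF L, of b]] by (simp add: case_prod_beta)
  have mx: "(\<lambda>v. rejections L b v x) \<in> borel_measurable dithers" for x
    using measurable_compose[OF measurable_Pair1'[of x ?U dithers] m] by simp
  have "(\<integral>\<^sup>+v. (\<integral>\<^sup>+x. a + ennreal (log 2 (1 / (1 - p))) * rejections L b v x \<partial>?U) \<partial>dithers)
      = (\<integral>\<^sup>+x. (\<integral>\<^sup>+v. a + ennreal (log 2 (1 / (1 - p))) * rejections L b v x \<partial>dithers) \<partial>?U)"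
    using DU.Fubini[of "\<lambda>w. a + ennreal (log 2 (1 / (1 - p))) * rejections L b (snd w) (fst w)"] by simp
  also have "\<dots> = (\<integral>\<^sup>+x. a + ennreal (log 2 (1 / (1 - p))) * ennreal ((1 - p) / p) \<partial>?U)"
    using mx by (intro nn_integral_cong)
      (simp add: nn_integral_add nn_integral_cmult nn_integral_rejections[OF L b LP p] prob_space.emeasure_space_1[OF D1])
  also have "\<dots> = a + ennreal (log 2 (1 / (1 - p))) * ennreal ((1 - p) / p)"
    by (simp only: nn_integral_const U.emeasure_space_1 mult_1_right)
  also have "\<dots> = a + ennreal (log 2 (1 / (1 - p)) * ((1 - p) / p))"
    using p(2,3) by (subst ennreal_mult) auto
  also have "\<dots> \<le> a + ennreal (log 2 (exp 1))"
    using geometric_entropy_bound[OF p(2,3)] by (intro add_left_mono ennreal_leI)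
  finally show ?thesis .
qed

end

section \<open>Averaging over the level\<close>

lemma distr_pair_measure_snd:
  assumes "prob_space M" "sigma_finite_measure N"
  shows "distr (M \<Otimes>\<^sub>M N) N snd = N"
proof (rule measure_eqI)
  interpret M: prob_space M by fact
  interpret N: sigma_finite_measure N by fact
  fix A assume "A \<in> sets (distr (M \<Otimes>\<^sub>M N) N snd)"
  then have A: "A \<in> sets N" by simp
  have "snd -` A \<inter> space (M \<Otimes>\<^sub>M N) = space M \<times> A"
    using sets.sets_into_space[OF A] by (auto simp: space_pair_measure)
  then show "emeasure (distr (M \<Otimes>\<^sub>M N) N snd) A = emeasure N A"
    using A by (simp add: emeasure_distr N.emeasure_pair_measure_Times M.emeasure_space_1)
qed simp

section \<open>Superlevel sets of a density\<close>

context
  fixes f :: "'a::euclidean_space \<Rightarrow> real"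
  assumes pdf: "is_pdf f"
begin

lemma pdf_measurable: "f \<in> borel_measurable borel"
  and pdf_nonneg: "0 \<le> f z" and pdf_integral: "(\<integral>\<^sup>+z. ennreal (f z) \<partial>lborel) = 1"
  using pdf by (auto simp: is_pdf_def)

lemma superlevel_sets: "superlevel f t \<in> sets borel"
  using pdf_measurable unfolding superlevel_def by measurable

lemma measurable_emeasure_superlevel:
  "(\<lambda>t. emeasure lborel (superlevel f t)) \<in> borel_measurable borel"
proof -
  note [measurable] = pdf_measurable
  have "{w \<in> space (borel \<Otimes>\<^sub>M lborel). fst w \<le> f (snd w)} \<in> sets (borel \<Otimes>\<^sub>M lborel)" by measurable
  from lborel.measurable_emeasure_Pair[OF this] show ?thesis
    by (simp add: superlevel_def space_pair_measure vimage_def)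
qed

lemma measurable_measure_superlevel:
  "(\<lambda>t. measure lborel (superlevel f t)) \<in> borel_measurable borel"
  using measurable_emeasure_superlevel unfolding measure_def by measurable

text \<open>The region below the graph of \<open>f\<close> is sliced by levels and, alternatively,
  by points. This makes the law of the level a probability measure.\<close>

lemma layer_cake:
  "(\<integral>\<^sup>+t. emeasure lborel (superlevel f t) * indicator {0<..} t \<partial>lborel) = 1"
proof -
  note [measurable] = pdf_measurable superlevel_sets
  have "(\<integral>\<^sup>+t. emeasure lborel (superlevel f t) * indicator {0<..} t \<partial>lborel)
      = (\<integral>\<^sup>+t. (\<integral>\<^sup>+z. indicator {w. 0 < fst w \<and> fst w \<le> f (snd w)} (t, z) \<partial>lborel) \<partial>lborel)"
  proof (rule nn_integral_cong)
    fix t :: real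
    have "emeasure lborel (superlevel f t) * indicator {0<..} t
        = (\<integral>\<^sup>+z. indicator {0<..} t * indicator (superlevel f t) z \<partial>lborel)"
      by (simp add: nn_integral_cmult_indicator mult.commute)
    also have "\<dots> = (\<integral>\<^sup>+z. indicator {w. 0 < fst w \<and> fst w \<le> f (snd w)} (t, z) \<partial>lborel)"
      by (intro nn_integral_cong) (auto simp: indicator_def superlevel_def)
    finally show "emeasure lborel (superlevel f t) * indicator {0<..} t
        = (\<integral>\<^sup>+z. indicator {w. 0 < fst w \<and> fst w \<le> f (snd w)} (t, z) \<partial>lborel)" .
  qed
  also have "\<dots> = (\<integral>\<^sup>+z. (\<integral>\<^sup>+t. indicator {w. 0 < fst w \<and> fst w \<le> f (snd w)} (t, z) \<partial>lborel) \<partial>lborel)"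
    by (rule lborel_pair.Fubini'[symmetric]) measurable
  also have "\<dots> = (\<integral>\<^sup>+z. ennreal (f z) \<partial>lborel)"
  proof (rule nn_integral_cong)
    fix z
    have "(\<integral>\<^sup>+t. indicator {w. 0 < fst w \<and> fst w \<le> f (snd w)} (t, z) \<partial>lborel)
        = (\<integral>\<^sup>+t. indicator {0<..f z} t \<partial>lborel)"
      by (intro nn_integral_cong) (auto simp: indicator_def)
    also have "\<dots> = ennreal (f z)" using pdf_nonneg[of z] by simp
    finally show "(\<integral>\<^sup>+t. indicator {w. 0 < fst w \<and> fst w \<le> f (snd w)} (t, z) \<partial>lborel) = ennreal (f z)" .
  qed
  also have "\<dots> = 1" by (rule pdf_integral)
  finally show ?thesis .
qed

end

context lattice_cell
begin

text \<open>Input and state are independent, so fixing the state yields the conditional law. Its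
  entropy is bounded state by state, then averaged over the dithers and finally over the level.
  Condition \<open>\<beta>0\<close> speaks only of levels of positive density, as the others have
  weight zero.\<close>

lemma cond_entropy_lrsuq_le:
  fixes f :: "real^'n \<Rightarrow> real"
  assumes pdf: "is_pdf f" and \<beta> [measurable]: "\<beta> \<in> borel_measurable borel"
    and bdd: "\<And>t. t > 0 \<Longrightarrow> bounded (superlevel f t)"
    and LP: "\<And>t. t > 0 \<Longrightarrow> superlevel f t \<subseteq> (\<lambda>p. \<beta> t *\<^sub>R p) ` P"
    and \<beta>0: "\<And>t. t > 0 \<Longrightarrow> 0 < measure lborel (superlevel f t) \<Longrightarrow>
        0 < \<beta> t \<and> measure lborel (superlevel f t) < \<beta> t ^ CARD('n) * measure lborel P"
    and C: "P \<subseteq> cball 0 C" and \<tau>: "\<tau> > 0"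
  shows "cond_entropy (uniform_measure lborel (cball 0 \<tau>) \<Otimes>\<^sub>M lrsuq_state f P) (lrsuq_state f P)
      (\<lambda>(x, s). lrsuq f G P \<beta> x s) snd
    \<le> (\<integral>\<^sup>+t\<in>{0<..}. ennreal (measure lborel (superlevel f t))
        * (ennreal (log 2 (measure lborel (cball (0::real^'n) (\<tau> + 2 * C * \<beta> t)) / measure lborel (superlevel f t)))
          + ennreal (log 2 (exp 1))) \<partial>lborel)"
proof -
  let ?U = "uniform_measure lborel (cball (0::real^'n) \<tau>)"
  let ?m = "\<lambda>t. measure lborel (superlevel f t)"
  define T where "T = density lborel (\<lambda>t. emeasure lborel (superlevel f t) * indicator {0<..} t)"
  note [measurable] = pdf_measurable[OF pdf] measurable_emeasure_superlevel[OF pdf]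
    measurable_measure_superlevel[OF pdf]
  interpret U: prob_space ?U by (rule prob_space_uniform_cball[OF \<tau>])
  interpret UP: prob_space "uniform_measure lborel P" by (rule prob_space_cell)
  interpret D: product_prob_space "\<lambda>_::nat. uniform_measure lborel P" UNIV
    by unfold_locales
  have D1: "prob_space dithers" by (rule D.prob_space_axioms)
  have D0: "sigma_finite_measure dithers" by (rule prob_space_imp_sigma_finite[OF D1])
  have sT [measurable_cong]: "sets T = sets borel" by (simp add: T_def)
  interpret T: prob_space T
    by (rule prob_spaceI) (simp add: T_def emeasure_density layer_cake[OF pdf])
  interpret TD: pair_prob_space T dithers
    by (intro pair_prob_space.intro pair_sigma_finite.intro prob_space_imp_sigma_finite T.prob_space_axioms D1)
  have state: "lrsuq_state f P = T \<Otimes>\<^sub>M dithers" by (simp add: lrsuq_state_def T_def)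
  have mQ: "(\<lambda>(x, s). lrsuq f G P \<beta> x s) \<in> ?U \<Otimes>\<^sub>M (T \<Otimes>\<^sub>M dithers) \<rightarrow>\<^sub>M borel"
  proof -
    have "sets (?U \<Otimes>\<^sub>M (T \<Otimes>\<^sub>M dithers)) = sets (borel \<Otimes>\<^sub>M (borel \<Otimes>\<^sub>M dithers))"
      by (intro sets_pair_measure_cong) (auto simp: sT)
    from measurable_cong_sets[OF this refl] measurable_lrsuq[of f \<beta>] show ?thesis by simp
  qed
  interpret UTD: pair_prob_space ?U "T \<Otimes>\<^sub>M dithers"
    by (intro pair_prob_space.intro pair_sigma_finite.intro prob_space_imp_sigma_finite
        U.prob_space_axioms TD.prob_space_axioms)
  define p where "p t = ?m t / (\<beta> t ^ CARD('n) * measure lborel P)" for t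
  have p: "0 < p t" "p t < 1" if "t > 0" "0 < ?m t" for t
    using \<beta>0[OF that] that measure_cell_pos by (auto simp: p_def)
  have [measurable]: "p \<in> borel_measurable borel" unfolding p_def by measurable
  define a where "a t = ennreal (log 2 (measure lborel (cball (0::real^'n) (\<tau> + 2 * C * \<beta> t)) / ?m t))" for t
  have [measurable]: "(\<lambda>r. measure lborel (cball (0::real^'n) r)) \<in> borel_measurable borel"
    by (rule borel_measurable_mono)
      (auto simp: mono_def intro!: measure_mono_fmeasurable fmeasurableI emeasure_bounded_finite)
  have [measurable]: "a \<in> borel_measurable borel" unfolding a_def by measurable
  \<comment> \<open>\<open>W\<close> is infinite where the density of the level vanishes, so it is a bound everywhere.\<close>
  define W where "W s = (if 0 < fst s \<and> 0 < ?m (fst s)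
      then (\<integral>\<^sup>+x. a (fst s) + ennreal (log 2 (1 / (1 - p (fst s)))) * rejections (superlevel f (fst s)) (\<beta> (fst s)) (snd s) x \<partial>?U)
      else \<infinity>)" for s
  have rej [measurable]: "(\<lambda>w. rejections (superlevel f (fst (fst w))) (\<beta> (fst (fst w))) (snd (fst w)) (snd w))
      \<in> borel_measurable ((T \<Otimes>\<^sub>M dithers) \<Otimes>\<^sub>M ?U)"
  proof -
    have "(\<lambda>w. (fst (fst w), snd (fst w), snd w)) \<in> (T \<Otimes>\<^sub>M dithers) \<Otimes>\<^sub>M ?U \<rightarrow>\<^sub>M borel \<Otimes>\<^sub>M dithers \<Otimes>\<^sub>M borel"
      by measurable
    from measurable_compose[OF this measurable_rejections[of f \<beta>]] show ?thesis by simp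
  qed
  have W [measurable]: "W \<in> borel_measurable (T \<Otimes>\<^sub>M dithers)"
    unfolding W_def by measurable
  have law: "cond_law (?U \<Otimes>\<^sub>M (T \<Otimes>\<^sub>M dithers)) (T \<Otimes>\<^sub>M dithers) (\<lambda>(x, s). lrsuq f G P \<beta> x s) snd
      (\<lambda>s. distr ?U borel (\<lambda>x. lrsuq f G P \<beta> x s))"
    by (rule cond_law_indep[OF U.prob_space_axioms TD.prob_space_axioms mQ])
  have "cond_entropy (?U \<Otimes>\<^sub>M lrsuq_state f P) (lrsuq_state f P) (\<lambda>(x, s). lrsuq f G P \<beta> x s) snd
      = (\<integral>\<^sup>+s. discrete_entropy (distr ?U borel (\<lambda>x. lrsuq f G P \<beta> x s)) \<partial>(T \<Otimes>\<^sub>M dithers))"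
    unfolding state cond_entropy_eq[OF UTD.prob_space_axioms law]
    by (simp add: distr_pair_measure_snd U.prob_space_axioms prob_space_imp_sigma_finite TD.prob_space_axioms)
  also have "\<dots> \<le> (\<integral>\<^sup>+s. W s \<partial>(T \<Otimes>\<^sub>M dithers))"
  proof (rule nn_integral_mono)
    fix s :: "real \<times> (nat \<Rightarrow> real^'n)"
    obtain t v where s: "s = (t, v)" by (cases s)
    show "discrete_entropy (distr ?U borel (\<lambda>x. lrsuq f G P \<beta> x s)) \<le> W s"
    proof (cases "0 < t \<and> 0 < ?m t")
      case True
      then show ?thesis
        using entropy_rejection_quantizer_le[OF superlevel_sets[OF pdf] _ LP C \<tau> p_def[of t], of v] \<beta>0[of t] p[of t]
        unfolding s W_def a_def lrsuq_eq by simp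
    next
      case False
      then have "W s = \<infinity>" unfolding s W_def fst_conv by (rule if_not_P)
      then show ?thesis by simp
    qed
  qed
  also have "\<dots> = (\<integral>\<^sup>+t. (\<integral>\<^sup>+v. W (t, v) \<partial>dithers) \<partial>T)"
    by (rule sigma_finite_measure.nn_integral_fst[OF D0, symmetric]) measurable
  also have "\<dots> = (\<integral>\<^sup>+t. (emeasure lborel (superlevel f t) * indicator {0<..} t) * (\<integral>\<^sup>+v. W (t, v) \<partial>dithers) \<partial>lborel)"
  proof -
    have "(\<lambda>t. \<integral>\<^sup>+v. W (t, v) \<partial>dithers) \<in> borel_measurable T"
      by (rule sigma_finite_measure.borel_measurable_nn_integral_fst[OF D0]) measurable
    then have "(\<lambda>t. \<integral>\<^sup>+v. W (t, v) \<partial>dithers) \<in> borel_measurable lborel"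
      by (simp add: measurable_cong_sets[OF sT refl])
    then show ?thesis unfolding T_def by (subst nn_integral_density) auto
  qed
  also have "\<dots> \<le> (\<integral>\<^sup>+t\<in>{0<..}. ennreal (?m t) * (a t + ennreal (log 2 (exp 1))) \<partial>lborel)"
  proof (rule nn_integral_mono)
    fix t :: real
    show "(emeasure lborel (superlevel f t) * indicator {0<..} t) * (\<integral>\<^sup>+v. W (t, v) \<partial>dithers)
      \<le> ennreal (?m t) * (a t + ennreal (log 2 (exp 1))) * indicator {0<..} t"
    proof (cases "t > 0")
      case True
      have e: "emeasure lborel (superlevel f t) = ennreal (?m t)"
        using emeasure_bounded_finite[OF bdd[OF True]] by (intro emeasure_eq_ennreal_measure) auto
      \<comment> \<open>A level of density zero contributes zero although \<open>W\<close> is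
        infinite there.\<close>
      show ?thesis
      proof (cases "?m t = 0")
        case False
        then have m: "0 < ?m t" by (simp add: zero_less_measure_iff)
        have "(\<integral>\<^sup>+v. W (t, v) \<partial>dithers) \<le> a t + ennreal (log 2 (exp 1))"
          using nn_integral_entropy_bound_le[OF superlevel_sets[OF pdf] _ LP[OF True] \<tau> p_def[of t] p(1,2)[OF True m], of "a t"]
            \<beta>0[OF True m] True m by (simp add: W_def)
        then show ?thesis using True by (simp add: e mult_left_mono)
      qed (simp add: e)
    qed simp
  qed
  finally show ?thesis unfolding a_def .
qed

end

section \<open>The unit cube and the tail condition\<close>

text \<open>Half-open, so that integer translates do not overlap, and centred, so that its positive
  multiples contain balls around the origin.\<close>

definition unit_cube :: "(real^'n) set" where
  "unit_cube = {x. \<forall>i. - 1 / 2 \<le> x $ i \<and> x $ i < 1 / 2}"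

lemma lattice_point_mat_1: "lattice_point (mat 1) j = (\<chi> i. of_int (j $ i))"
  by (simp add: lattice_point_def)

lemma unit_cube_sets: "unit_cube \<in> sets borel"
proof -
  have "unit_cube = (\<Inter>i. {x::real^'n. - 1 / 2 \<le> x $ i} \<inter> {x. x $ i < 1 / 2})"
    by (auto simp: unit_cube_def)
  also have "\<dots> \<in> sets borel"
    by (intro sets.finite_INT sets.Int borel_closed borel_open closed_Collect_le open_Collect_less
        continuous_intros) auto
  finally show ?thesis .
qed

lemma basic_cell_unit_cube: "basic_cell (mat 1) (unit_cube :: (real^'n) set)"
  unfolding basic_cell_def
proof (intro conjI)
  have "unit_cube \<subseteq> (cbox (\<chi> i. - 1 / 2) (\<chi> i. 1 / 2) :: (real^'n) set)"
    by (auto simp: unit_cube_def mem_box_cart less_imp_le)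
  then show "bounded (unit_cube :: (real^'n) set)" by (rule bounded_subset[OF bounded_cbox])
  show "unit_cube \<in> sets (borel :: (real^'n) measure)" by (rule unit_cube_sets)
  show "disjoint_family (\<lambda>j. (\<lambda>p. p + lattice_point (mat 1) j) ` (unit_cube :: (real^'n) set))"
    unfolding disjoint_family_on_def
  proof (intro ballI impI, rule ccontr)
    fix i j :: "int^'n"
    assume ij: "i \<noteq> j" and "(\<lambda>p. p + lattice_point (mat 1) i) ` unit_cube \<inter> (\<lambda>p. p + lattice_point (mat 1) j) ` unit_cube \<noteq> {}"
    then obtain p q where pq: "p \<in> unit_cube" "q \<in> unit_cube"
      "p + lattice_point (mat 1) i = q + lattice_point (mat 1) j" by auto
    have "i $ k = j $ k" for k
    proof -
      have "p $ k + of_int (i $ k) = q $ k + of_int (j $ k)"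
        using arg_cong[OF pq(3), of "\<lambda>x. x $ k"] by (simp add: lattice_point_mat_1)
      moreover have "- 1 / 2 \<le> p $ k" "p $ k < 1 / 2" "- 1 / 2 \<le> q $ k" "q $ k < 1 / 2"
        using pq by (auto simp: unit_cube_def)
      ultimately show ?thesis by linarith
    qed
    then show False using ij by (simp add: vec_eq_iff)
  qed
  show "(\<Union>j. (\<lambda>p. p + lattice_point (mat 1) j) ` unit_cube) = (UNIV :: (real^'n) set)"
  proof (intro set_eqI iffI UNIV_I)
    fix x :: "real^'n"
    \<comment> \<open>Rounding to the nearest integer; the shift by \<open>1 / 2\<close> inside the
      floor matches the closed side of the cube.\<close>
    define j :: "int^'n" where "j = (\<chi> i. \<lfloor>x $ i + 1 / 2\<rfloor>)"
    have "x - lattice_point (mat 1) j \<in> unit_cube"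
      unfolding unit_cube_def lattice_point_mat_1 j_def
    proof (intro CollectI allI)
      fix i
      show "- 1 / 2 \<le> (x - (\<chi> i. of_int ((\<chi> i. \<lfloor>x $ i + 1 / 2\<rfloor>) $ i))) $ i \<and>
        (x - (\<chi> i. of_int ((\<chi> i. \<lfloor>x $ i + 1 / 2\<rfloor>) $ i))) $ i < 1 / 2"
        by simp linarith
    qed
    then show "x \<in> (\<Union>j. (\<lambda>p. p + lattice_point (mat 1) j) ` unit_cube)"
      by (auto intro!: UN_I[of j] image_eqI[where x="x - lattice_point (mat 1) j"])
  qed
qed

section \<open>Volumes of cubes\<close>

lemma measure_cbox_symmetric:
  fixes r :: real
  assumes "r \<ge> 0"
  shows "measure lborel (cbox (\<chi> i. - r) (\<chi> i. r) :: (real^'n) set) = (2 * r) ^ CARD('n)"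
proof -
  have "cbox (\<chi> i. - r) (\<chi> i. r) \<noteq> ({} :: (real^'n) set)"
    using assms by (auto simp: interval_ne_empty_cart)
  from content_cbox_cart[OF this] show ?thesis by simp
qed

lemma measure_unit_cube: "measure lborel (unit_cube :: (real^'n) set) = 1"
proof (rule antisym)
  let ?C = "cbox (\<chi> i. - (1 / 2)) (\<chi> i. 1 / 2) :: (real^'n) set"
  let ?B = "box (\<chi> i. - (1 / 2)) (\<chi> i. 1 / 2) :: (real^'n) set"
  have C1: "measure lborel ?C = 1" using measure_cbox_symmetric[of "1 / 2", where 'n='n] by simp
  have "measure lborel (unit_cube :: (real^'n) set) \<le> measure lborel ?C"
    by (rule measure_mono_fmeasurable)
       (auto simp: unit_cube_def mem_box_cart less_imp_le unit_cube_sets[unfolded unit_cube_def])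
  then show "measure lborel (unit_cube :: (real^'n) set) \<le> 1" by (simp only: C1)
  have "measure lborel ?C = measure lborel ?B"
    by (simp add: measure_def emeasure_lborel_cbox_eq emeasure_lborel_box_eq)
  also have "\<dots> \<le> measure lborel (unit_cube :: (real^'n) set)"
  proof (rule measure_mono_fmeasurable)
    show "unit_cube \<in> fmeasurable (lborel :: (real^'n) measure)"
      using basic_cell_unit_cube emeasure_bounded_finite unfolding basic_cell_def
      by (intro fmeasurableI) (auto simp del: infinity_ennreal_def)
  qed (auto simp: unit_cube_def mem_box_cart less_imp_le)
  finally show "1 \<le> measure lborel (unit_cube :: (real^'n) set)" by (simp only: C1)
qed

text \<open>Inserting \<open>0\<close> keeps the supremum meaningful for an empty superlevel set.\<close>

definition level_radius :: "('a::real_normed_vector \<Rightarrow> real) \<Rightarrow> real \<Rightarrow> real" where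
  "level_radius f t = (if t > 0 then Sup (insert 0 (norm ` superlevel f t)) else 0)"

text \<open>On the upper half of the interval the integrand is at least its value at
  \<open>r / 2\<close>. Of the constant, \<open>2 ^ n\<close> comes from \<open>(r / 2) ^ n\<close>
  and the last factor 2 from \<open>1 + r \<le> (1 + r / 2) ^ 2\<close>.\<close>

lemma ennreal_power_tail_le:
  fixes r :: real
  assumes n: "n > 0" and r: "0 \<le> r"
  shows "ennreal (r ^ n * log 2 (1 + r) / 2 ^ (n + 1))
    \<le> (\<integral>\<^sup>+x. ennreal (x ^ (n - 1) * log 2 (1 + x)) * indicator {0<..<r} x \<partial>lborel)"
proof (cases "r = 0")
  case False
  with r have r: "0 < r" by simp
  have "log 2 (1 + r) \<le> log 2 ((1 + r / 2) ^ 2)"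
    using r by (subst log_le_cancel_iff) (auto simp: power2_eq_square algebra_simps add_pos_pos)
  also have "\<dots> = 2 * log 2 (1 + r / 2)" using r by (simp add: log_nat_power)
  finally have half: "log 2 (1 + r) / 2 \<le> log 2 (1 + r / 2)" by simp
  have "r ^ n * log 2 (1 + r) / 2 ^ (n + 1) = (r / 2) ^ n * (log 2 (1 + r) / 2)"
    by (simp add: power_divide)
  also have "\<dots> \<le> (r / 2) ^ n * log 2 (1 + r / 2)"
    using half r by (intro mult_left_mono) auto
  also have "\<dots> = (r / 2) ^ (n - 1) * log 2 (1 + r / 2) * (r / 2)"
    using n by (cases n) auto
  finally have "ennreal (r ^ n * log 2 (1 + r) / 2 ^ (n + 1))
      \<le> ennreal ((r / 2) ^ (n - 1) * log 2 (1 + r / 2) * (r / 2))" by (rule ennreal_leI)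
  also have "\<dots> = ennreal ((r / 2) ^ (n - 1) * log 2 (1 + r / 2)) * emeasure lborel {r / 2<..<r}"
    using r by (subst ennreal_mult) auto
  also have "\<dots> = (\<integral>\<^sup>+x. ennreal ((r / 2) ^ (n - 1) * log 2 (1 + r / 2)) * indicator {r / 2<..<r} x \<partial>lborel)"
    by (simp add: nn_integral_cmult_indicator)
  also have "\<dots> \<le> (\<integral>\<^sup>+x. ennreal (x ^ (n - 1) * log 2 (1 + x)) * indicator {0<..<r} x \<partial>lborel)"
    using r by (intro nn_integral_mono)
      (auto simp: indicator_def intro!: ennreal_leI mult_mono power_mono)
  finally show ?thesis .
qed (use n in simp)

section \<open>Consequences of the tail condition\<close>

context
  fixes f :: "real^'n \<Rightarrow> real"
  assumes pdf: "is_pdf f"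
    and tail: "(\<integral>\<^sup>+x\<in>{0<..}. (SUP z\<in>{z. norm z \<ge> x}. ennreal (f z))
           * ennreal (x ^ (CARD('n) - 1) * log 2 (1 + x)) \<partial>lborel) < \<infinity>"
begin

text \<open>Otherwise the supremum over \<open>norm z \<ge> x\<close> would be at least
  \<open>t\<close> for every \<open>x\<close>; as the weight is at least 1 beyond
  \<open>x = 1\<close>, the tail integral would diverge.\<close>

lemma bounded_superlevel:
  assumes t: "t > 0"
  shows "bounded (superlevel f t)"
proof (rule ccontr)
  assume unb: "\<not> bounded (superlevel f t)"
  have "(\<integral>\<^sup>+x. ennreal t * indicator {1<..} (x::real) \<partial>lborel)
    \<le> (\<integral>\<^sup>+x\<in>{0<..}. (SUP z\<in>{z. norm z \<ge> x}. ennreal (f z))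
           * ennreal (x ^ (CARD('n) - 1) * log 2 (1 + x)) \<partial>lborel)"
  proof (rule nn_integral_mono)
    fix x :: real
    show "ennreal t * indicator {1<..} x \<le> (SUP z\<in>{z. norm z \<ge> x}. ennreal (f z))
           * ennreal (x ^ (CARD('n) - 1) * log 2 (1 + x)) * indicator {0<..} x"
    proof (cases "x > 1")
      case True
      obtain z where z: "z \<in> superlevel f t" "x < norm z"
        using unb by (force simp: bounded_iff not_le)
      have "ennreal t \<le> ennreal (f z)" using z by (auto simp: superlevel_def intro: ennreal_leI)
      also have "\<dots> \<le> (SUP z\<in>{z. norm z \<ge> x}. ennreal (f z))"
        using z by (intro SUP_upper) auto
      finally have 1: "ennreal t \<le> (SUP z\<in>{z. norm z \<ge> x}. ennreal (f z))" .
      have "1 \<le> log 2 (1 + x)" using True by (subst one_le_log_cancel_iff) auto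
      moreover have "1 \<le> x ^ (CARD('n) - 1)" using True by (intro one_le_power) auto
      ultimately have "1 * 1 \<le> x ^ (CARD('n) - 1) * log 2 (1 + x)" by (intro mult_mono) auto
      then have "1 \<le> ennreal (x ^ (CARD('n) - 1) * log 2 (1 + x))" using ennreal_leI by fastforce
      from mult_mono[OF 1 this] show ?thesis using True by simp
    qed simp
  qed
  also have "\<dots> < \<infinity>" by (rule tail)
  finally have fin: "(\<integral>\<^sup>+x. ennreal t * indicator {1<..} (x::real) \<partial>lborel) < \<infinity>" .
  have "(\<integral>\<^sup>+x. ennreal t * indicator {1<..} (x::real) \<partial>lborel) = \<infinity>"
  proof -
    have "emeasure lborel {1::real<..} = \<infinity>"
    proof -
      have "ennreal (real k) \<le> emeasure lborel {1::real<..}" for k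
      proof -
        have "ennreal (real k) = emeasure lborel {1<..<1 + real k}" by simp
        also have "\<dots> \<le> emeasure lborel {1::real<..}" by (intro emeasure_mono) auto
        finally show ?thesis .
      qed
      then show ?thesis
        using ennreal_Ex_less_of_nat[of "emeasure lborel {1::real<..}"]
        by (metis ennreal_of_nat_eq_real_of_nat infinity_ennreal_def leD top.not_eq_extremum)
    qed
    then show ?thesis using t by (simp add: nn_integral_cmult_indicator ennreal_mult_top)
  qed
  with fin show False by simp
qed

lemma bdd_above_norms: "t > 0 \<Longrightarrow> bdd_above (insert 0 (norm ` superlevel f t))"
  by (simp add: bounded_superlevel bounded_imp_bdd_above bounded_norm_comp[of "\<lambda>x. x", simplified])

lemma level_radius_nonneg: "0 \<le> level_radius f t"
  using bdd_above_norms[of t] by (auto simp: level_radius_def intro!: cSup_upper)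

lemma norm_le_level_radius: "t > 0 \<Longrightarrow> z \<in> superlevel f t \<Longrightarrow> norm z \<le> level_radius f t"
  using bdd_above_norms[of t] by (auto simp: level_radius_def intro!: cSup_upper)

text \<open>By \<open>0 \<le> x\<close> the element found above \<open>x\<close> is a genuine norm
  and not the inserted 0.\<close>

lemma less_level_radiusD:
  assumes "t > 0" "0 \<le> x" "x < level_radius f t"
  shows "\<exists>z\<in>superlevel f t. x < norm z"
  using assms less_cSup_iff[OF _ bdd_above_norms[of t], of x] by (auto simp: level_radius_def)

lemma measurable_level_radius: "level_radius f \<in> borel_measurable borel"
proof -
  \<comment> \<open>Superlevel sets shrink as the level grows, so the radius is antitone on positive
    levels.\<close>
  have "mono_on {0<..} (\<lambda>t. - level_radius f t)"
  proof (rule mono_onI)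
    fix s t :: real assume st: "s \<in> {0<..}" "t \<in> {0<..}" "s \<le> t"
    have "insert 0 (norm ` superlevel f t) \<subseteq> insert 0 (norm ` superlevel f s)"
      using st by (auto simp: superlevel_def)
    then have "Sup (insert 0 (norm ` superlevel f t)) \<le> Sup (insert 0 (norm ` superlevel f s))"
      using bdd_above_norms[of s] st by (intro cSup_subset_mono) auto
    then show "- level_radius f s \<le> - level_radius f t" using st by (simp add: level_radius_def)
  qed
  then have "(\<lambda>t. - level_radius f t) \<in> borel_measurable (restrict_space borel {0<..})"
    by (rule borel_measurable_mono_on_fnc)
  then have "(\<lambda>t. indicator {0<..} t *\<^sub>R (- level_radius f t)) \<in> borel_measurable borel"
    by (subst (asm) borel_measurable_restrict_space_iff) auto
  then have "(\<lambda>t. - (indicator {0<..} t *\<^sub>R (- level_radius f t))) \<in> borel_measurable borel"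
    by (rule borel_measurable_uminus)
  also have "(\<lambda>t. - (indicator {0<..} t *\<^sub>R (- level_radius f t))) = level_radius f"
    by (auto simp: fun_eq_iff indicator_def level_radius_def)
  finally show ?thesis .
qed

text \<open>A ball lies in the cube with side twice its radius, whose volume compares directly with
  that of a scaled unit cube.\<close>

lemma measure_superlevel_le: 
  assumes "t > 0"
  shows "measure lborel (superlevel f t) \<le> (2 * level_radius f t) ^ CARD('n)"
proof -
  let ?r = "level_radius f t"
  have "measure lborel (superlevel f t) \<le> measure lborel (cbox (\<chi> i. - ?r) (\<chi> i. ?r) :: (real^'n) set)"
  proof (rule measure_mono_fmeasurable)
    show "superlevel f t \<subseteq> cbox (\<chi> i. - ?r) (\<chi> i. ?r)"
    proof
      fix z assume "z \<in> superlevel f t"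
      then have "\<bar>z $ i\<bar> \<le> ?r" for i
        using norm_le_level_radius[OF assms] component_le_norm_cart[of z i] by fastforce
      then show "z \<in> cbox (\<chi> i. - ?r) (\<chi> i. ?r)" by (auto simp: mem_box_cart abs_le_iff minus_le_iff)
    qed
  qed (use superlevel_sets[OF pdf] in auto)
  then show ?thesis by (simp add: measure_cbox_symmetric level_radius_nonneg)
qed

text \<open>Up to a constant, \<open>ennreal_power_tail_le\<close> bounds the integrand by the tail
  weight integrated over radii below \<open>level_radius f t\<close>. After Tonelli, the levels
  whose radius exceeds \<open>x\<close> are at most the supremum of \<open>f\<close> over
  \<open>norm z \<ge> x\<close>, and the tail condition appears.\<close>

lemma nn_integral_level_radius:
  "(\<integral>\<^sup>+t\<in>{0<..}. ennreal (level_radius f t ^ CARD('n) * log 2 (1 + level_radius f t)) \<partial>lborel) < \<infinity>"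
proof -
  note [measurable] = measurable_level_radius
  let ?n = "CARD('n)" and ?r = "level_radius f"
  let ?w = "\<lambda>x::real. ennreal (x ^ (?n - 1) * log 2 (1 + x))"
  let ?g = "\<lambda>x::real. SUP z\<in>{z. norm z \<ge> x}. ennreal (f z)"
  have "(\<integral>\<^sup>+t\<in>{0<..}. ennreal (?r t ^ ?n * log 2 (1 + ?r t) / 2 ^ (?n + 1)) \<partial>lborel)
      \<le> (\<integral>\<^sup>+t. (\<integral>\<^sup>+x. ?w x * indicator {(t, x). 0 < t \<and> 0 < x \<and> x < ?r t} (t, x) \<partial>lborel) \<partial>lborel)"
  proof (rule nn_integral_mono)
    fix t :: real
    show "ennreal (?r t ^ ?n * log 2 (1 + ?r t) / 2 ^ (?n + 1)) * indicator {0<..} t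
        \<le> (\<integral>\<^sup>+x. ?w x * indicator {(t, x). 0 < t \<and> 0 < x \<and> x < ?r t} (t, x) \<partial>lborel)"
    proof (cases "t > 0")
      case True
      have "ennreal (?r t ^ ?n * log 2 (1 + ?r t) / 2 ^ (?n + 1))
          \<le> (\<integral>\<^sup>+x. ?w x * indicator {0<..<?r t} x \<partial>lborel)"
        by (rule ennreal_power_tail_le) (auto simp: level_radius_nonneg)
      also have "\<dots> = (\<integral>\<^sup>+x. ?w x * indicator {(t, x). 0 < t \<and> 0 < x \<and> x < ?r t} (t, x) \<partial>lborel)"
        using True by (intro nn_integral_cong) (auto simp: indicator_def)
      finally show ?thesis using True by simp
    qed simp
  qed
  also have "\<dots> = (\<integral>\<^sup>+x. (\<integral>\<^sup>+t. ?w x * indicator {(t, x). 0 < t \<and> 0 < x \<and> x < ?r t} (t, x) \<partial>lborel) \<partial>lborel)"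
    by (rule lborel_pair.Fubini'[symmetric]) measurable
  also have "\<dots> \<le> (\<integral>\<^sup>+x\<in>{0<..}. ?g x * ?w x \<partial>lborel)"
  proof (rule nn_integral_mono)
    fix x :: real
    show "(\<integral>\<^sup>+t. ?w x * indicator {(t, x). 0 < t \<and> 0 < x \<and> x < ?r t} (t, x) \<partial>lborel) \<le> ?g x * ?w x * indicator {0<..} x"
    proof (cases "x > 0")
      case True
      let ?A = "{t. 0 < t \<and> x < ?r t}"
      have A: "?A \<in> sets lborel" by measurable
      have "(\<integral>\<^sup>+t. ?w x * indicator {(t, x). 0 < t \<and> 0 < x \<and> x < ?r t} (t, x) \<partial>lborel)
          = (\<integral>\<^sup>+t. ?w x * indicator ?A t \<partial>lborel)"
        using True by (intro nn_integral_cong) (auto simp: indicator_def)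
      also have "\<dots> = ?w x * emeasure lborel ?A" by (rule nn_integral_cmult_indicator[OF A])
      also have "\<dots> \<le> ?w x * ?g x"
      proof (rule mult_left_mono)
        \<comment> \<open>An infinite supremum bounds any measure; a finite one confines the levels
          to an interval of that length.\<close>
        show "emeasure lborel ?A \<le> ?g x"
        proof (cases "?g x")
          case (real c)
          have "?A \<subseteq> {0<..c}"
          proof safe
            fix t assume t: "0 < t" "x < ?r t"
            then obtain z where z: "z \<in> superlevel f t" "x < norm z" using less_level_radiusD[of t x] True by auto
            have "ennreal t \<le> ennreal (f z)" using z by (auto simp: superlevel_def intro: ennreal_leI)
            also have "\<dots> \<le> ?g x" using z by (intro SUP_upper) auto
            finally show "t \<in> {0<..c}" using t real by simp
          qed
          then have "emeasure lborel ?A \<le> emeasure lborel {0<..c}" by (intro emeasure_mono) auto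
          then show ?thesis using real by simp
        next
          case top
          show ?thesis unfolding top by (rule top_greatest)
        qed
      qed simp
      finally show ?thesis using True by (simp add: mult.commute)
    qed simp
  qed
  also have "\<dots> < \<infinity>" by (rule tail)
  finally have fin: "(\<integral>\<^sup>+t\<in>{0<..}. ennreal (?r t ^ ?n * log 2 (1 + ?r t) / 2 ^ (?n + 1)) \<partial>lborel) < \<infinity>" .
  have "(\<integral>\<^sup>+t\<in>{0<..}. ennreal (?r t ^ ?n * log 2 (1 + ?r t)) \<partial>lborel)
      = (\<integral>\<^sup>+t. ennreal (2 ^ (?n + 1)) * (ennreal (?r t ^ ?n * log 2 (1 + ?r t) / 2 ^ (?n + 1)) * indicator {0<..} t) \<partial>lborel)"
  proof (rule nn_integral_cong)
    fix t
    have "0 \<le> ?r t ^ ?n * log 2 (1 + ?r t)" using level_radius_nonneg[of t] by simp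
    then have "ennreal (?r t ^ ?n * log 2 (1 + ?r t))
        = ennreal (2 ^ (?n + 1)) * ennreal (?r t ^ ?n * log 2 (1 + ?r t) / 2 ^ (?n + 1))"
      by (subst ennreal_mult[symmetric]) auto
    then show "ennreal (?r t ^ ?n * log 2 (1 + ?r t)) * indicator {0<..} t
        = ennreal (2 ^ (?n + 1)) * (ennreal (?r t ^ ?n * log 2 (1 + ?r t) / 2 ^ (?n + 1)) * indicator {0<..} t)"
      by (simp only: mult.assoc)
  qed
  also have "\<dots> = ennreal (2 ^ (?n + 1)) * (\<integral>\<^sup>+t\<in>{0<..}. ennreal (?r t ^ ?n * log 2 (1 + ?r t) / 2 ^ (?n + 1)) \<partial>lborel)"
    by (rule nn_integral_cmult) measurable
  also have "\<dots> < \<infinity>" using fin by (simp add: ennreal_mult_less_top)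
  finally show ?thesis .
qed

end

theorem corollary17:
  fixes f :: "real^'n \<Rightarrow> real"
  assumes "is_pdf f"
    and "(\<integral>\<^sup>+x\<in>{0<..}. (SUP z\<in>{z. norm z \<ge> x}. ennreal (f z))
           * ennreal (x ^ (CARD('n) - 1) * log 2 (1 + x)) \<partial>lborel) < \<infinity>"
  shows "\<exists>(G :: real^'n^'n) P \<beta>. is_lrsuq f G P \<beta> \<and>
           normalized_entropy (lrsuq_state f P) (lrsuq f G P \<beta>)
             \<le> - layered_entropy f + ereal (log 2 (exp 1))"
proof -

  \<comment> \<open>Choice of the cell and of the scaling function\<close>
  note pdf = assms(1) and tail = assms(2)
  let ?n = "CARD('n)" and ?m = "\<lambda>t. measure lborel (superlevel f t)"
  let ?r = "level_radius f" and ?P = "unit_cube :: (real^'n) set"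
  \<comment> \<open>The scaled cube has half-side \<open>2 * ?r t\<close>. The slack over
    \<open>?r t\<close> covers the open faces and makes the acceptance probability strictly smaller
    than 1.\<close>
  define \<beta> where "\<beta> t = 4 * ?r t" for t
  note [measurable] = pdf_measurable[OF pdf] measurable_measure_superlevel[OF pdf]
    measurable_level_radius[OF pdf tail]
  have \<beta>_meas [measurable]: "\<beta> \<in> borel_measurable borel" unfolding \<beta>_def by measurable
  interpret lattice_cell "mat 1 :: real^'n^'n" ?P
    by unfold_locales (rule basic_cell_unit_cube)
  have r0: "0 \<le> ?r t" for t by (rule level_radius_nonneg[OF pdf tail])
  have log_r0: "0 \<le> log 2 (1 + ?r t)" for t using r0[of t] by simp
  have LP: "superlevel f t \<subseteq> (\<lambda>p. \<beta> t *\<^sub>R p) ` ?P" if t: "t > 0" for t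
  proof
    fix z assume "z \<in> superlevel f t"
    then have z: "norm z \<le> ?r t" by (rule norm_le_level_radius[OF pdf tail t])
    show "z \<in> (\<lambda>p. \<beta> t *\<^sub>R p) ` ?P"
    \<comment> \<open>At radius zero the superlevel set contains at most the origin, and the scaled
      cell degenerates to the origin.\<close>
    proof (cases "?r t = 0")
      case True
      then show ?thesis using z by (auto simp: \<beta>_def unit_cube_def intro!: image_eqI[where x=0])
    next
      case False
      with r0[of t] have r: "0 < ?r t" by simp
      have "\<bar>z $ i\<bar> \<le> ?r t" for i using component_le_norm_cart[of z i] z by linarith
      then have quarter: "\<bar>z $ i / (4 * ?r t)\<bar> \<le> 1 / 4" for i using r by (simp add: abs_divide pos_divide_le_eq)
      have "- 1 / 2 \<le> z $ i / (4 * ?r t) \<and> z $ i / (4 * ?r t) < 1 / 2" for i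
        using quarter[of i] by linarith
      then have "(1 / \<beta> t) *\<^sub>R z \<in> ?P" by (simp add: unit_cube_def \<beta>_def)
      then show ?thesis using r by (intro image_eqI[where x="(1 / \<beta> t) *\<^sub>R z"]) (auto simp: \<beta>_def)
    qed
  qed
  have r_pos: "0 < ?r t" if t: "t > 0" and m: "0 < ?m t" for t
    using measure_superlevel_le[OF pdf tail t] m r0[of t] by (cases "?r t = 0") (auto simp: power_0_left)
  have \<beta>_pos: "0 < \<beta> t \<and> ?m t < \<beta> t ^ ?n * measure lborel ?P" if t: "t > 0" and m: "0 < ?m t" for t
  proof -
    have "?m t \<le> (2 * ?r t) ^ ?n" by (rule measure_superlevel_le[OF pdf tail t])
    also have "\<dots> < (4 * ?r t) ^ ?n" using r_pos[OF t m] by (intro power_strict_mono) auto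
    finally show ?thesis using r_pos[OF t m] by (simp add: \<beta>_def measure_unit_cube)
  qed
  have bdd: "bounded (superlevel f t)" if "t > 0" for t by (rule bounded_superlevel[OF pdf tail that])
  have lrsuq: "is_lrsuq f (mat 1) ?P \<beta>"
    unfolding is_lrsuq_def admissible_scaling_def
    using basic_cell_unit_cube pdf bdd LP \<beta>_meas r0 by (auto simp: rank_I \<beta>_def)

  \<comment> \<open>Integrability over the level and the limit of large balls\<close>
  obtain C where C: "0 < C" "?P \<subseteq> cball 0 C"
    using bounded_cell unfolding bounded_pos by (metis mem_cball_0 subsetI)
  define V where "V = unit_ball_vol (real ?n)"
  have V: "0 < V" by (simp add: V_def)
  have ball: "measure lborel (cball (0::real^'n) R) = V * R ^ ?n" if "0 \<le> R" for R
    using content_cball[OF that, of "0::real^'n"] by (simp add: V_def)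
  \<comment> \<open>\<open>g\<close> is the integrand of the layered entropy, \<open>m\<close> the
    density of the level, and \<open>J \<tau>\<close> the loss from enlarging the ball of radius
    \<open>\<tau>\<close>; all are cut off to positive levels.\<close>
  define g where "g t = indicator {0<..} t * (?m t * log 2 (?m t))" for t
  define J where "J \<tau> t = indicator {0<..} t * (?m t * (real ?n * log 2 (1 + 2 * C * \<beta> t / \<tau>)))" for \<tau> t
  define m where "m t = indicator {0<..} t * ?m t" for t
  have [measurable]: "g \<in> borel_measurable borel" "J \<tau> \<in> borel_measurable borel" "m \<in> borel_measurable borel" for \<tau>
    unfolding g_def J_def m_def by measurable
  have emeas: "emeasure lborel (superlevel f t) = ennreal (?m t)" if "t > 0" for t
    using emeasure_bounded_finite[OF bdd[OF that]] by (intro emeasure_eq_ennreal_measure) auto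
  have m_int: "integrable lborel m" "(\<integral>t. m t \<partial>lborel) = 1"
  proof -
    have "(\<integral>\<^sup>+t. ennreal (m t) \<partial>lborel)
        = (\<integral>\<^sup>+t. emeasure lborel (superlevel f t) * indicator {0<..} t \<partial>lborel)"
      by (intro nn_integral_cong) (auto simp: m_def indicator_def emeas)
    then have 1: "(\<integral>\<^sup>+t. ennreal (m t) \<partial>lborel) = 1" by (simp add: layer_cake[OF pdf])
    have m0: "0 \<le> m t" for t by (simp add: m_def)
    show "integrable lborel m" using m0 1 by (intro integrableI_nonneg) auto
    show "(\<integral>t. m t \<partial>lborel) = 1" using m0 1 by (subst integral_eq_nn_integral) auto
  qed
  have mr_int: "integrable lborel (\<lambda>t. m t * log 2 (1 + ?r t))"
  proof (rule integrableI_nonneg)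
    show "AE t in lborel. 0 \<le> m t * log 2 (1 + ?r t)"
      by (intro AE_I2 mult_nonneg_nonneg) (simp_all add: m_def log_r0)
    have "(\<integral>\<^sup>+t. ennreal (m t * log 2 (1 + ?r t)) \<partial>lborel)
        \<le> (\<integral>\<^sup>+t. ennreal (2 ^ ?n) * (ennreal (?r t ^ ?n * log 2 (1 + ?r t)) * indicator {0<..} t) \<partial>lborel)"
    proof (rule nn_integral_mono)
      fix t :: real
      show "ennreal (m t * log 2 (1 + ?r t)) \<le> ennreal (2 ^ ?n) * (ennreal (?r t ^ ?n * log 2 (1 + ?r t)) * indicator {0<..} t)"
      proof (cases "t > 0")
        case True
        have "m t * log 2 (1 + ?r t) \<le> (2 * ?r t) ^ ?n * log 2 (1 + ?r t)"
          using measure_superlevel_le[OF pdf tail True] r0[of t] True by (intro mult_right_mono) (auto simp: m_def)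
        also have "\<dots> = 2 ^ ?n * (?r t ^ ?n * log 2 (1 + ?r t))" by (simp add: power_mult_distrib)
        finally show ?thesis using True r0[of t] by (simp add: ennreal_mult[symmetric] ennreal_leI)
      qed (simp add: m_def)
    qed
    also have "\<dots> = ennreal (2 ^ ?n) * (\<integral>\<^sup>+t\<in>{0<..}. ennreal (?r t ^ ?n * log 2 (1 + ?r t)) \<partial>lborel)"
      by (rule nn_integral_cmult) measurable
    also have "\<dots> < \<infinity>" using nn_integral_level_radius[OF pdf tail] by (simp add: ennreal_mult_less_top)
    finally show "(\<integral>\<^sup>+t. ennreal (m t * log 2 (1 + ?r t)) \<partial>lborel) < \<infinity>" .
  qed simp
  \<comment> \<open>For \<open>\<tau> \<ge> 1\<close> the argument of the logarithm in
    \<open>J\<close> is at most \<open>(1 + 8 * C) * (1 + ?r t)\<close>, where 8 is 2 times the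
    factor 4 of \<open>\<beta>\<close>; this gives a majorant free of \<open>\<tau>\<close>.\<close>
  define dom where "dom t = real ?n * log 2 (1 + 8 * C) * m t + real ?n * (m t * log 2 (1 + ?r t))" for t
  have dom_int: "integrable lborel dom" unfolding dom_def using m_int(1) mr_int by auto
  have J_le: "norm (J \<tau> t) \<le> dom t" if \<tau>: "1 \<le> \<tau>" for \<tau> t
  proof -
    have "2 * C * \<beta> t / \<tau> \<le> 2 * C * \<beta> t / 1"
      using \<tau> C r0[of t] by (intro divide_left_mono) (auto simp: \<beta>_def)
    then have "1 + 2 * C * \<beta> t / \<tau> \<le> 1 + 8 * C * ?r t" by (simp add: \<beta>_def)
    also have "\<dots> \<le> (1 + 8 * C) * (1 + ?r t)" using C r0[of t] by (simp add: algebra_simps)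
    finally have le: "1 + 2 * C * \<beta> t / \<tau> \<le> (1 + 8 * C) * (1 + ?r t)" .
    have ge: "1 \<le> 1 + 2 * C * \<beta> t / \<tau>" using \<tau> C r0[of t] by (simp add: \<beta>_def)
    have "log 2 (1 + 2 * C * \<beta> t / \<tau>) \<le> log 2 ((1 + 8 * C) * (1 + ?r t))"
      using le ge by (subst log_le_cancel_iff) linarith+
    also have "\<dots> = log 2 (1 + 8 * C) + log 2 (1 + ?r t)"
      using C r0[of t] by (subst log_mult) auto
    finally have "m t * (real ?n * log 2 (1 + 2 * C * \<beta> t / \<tau>))
        \<le> m t * (real ?n * (log 2 (1 + 8 * C) + log 2 (1 + ?r t)))"
      by (intro mult_left_mono) (auto simp: m_def)
    moreover have "0 \<le> J \<tau> t" unfolding J_def using ge by (intro mult_nonneg_nonneg) auto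
    moreover have "J \<tau> t = m t * (real ?n * log 2 (1 + 2 * C * \<beta> t / \<tau>))" by (simp add: J_def m_def)
    ultimately show ?thesis by (simp add: dom_def algebra_simps)
  qed
  have J_int: "integrable lborel (J \<tau>)" if "1 \<le> \<tau>" for \<tau>
  proof (rule Bochner_Integration.integrable_bound[OF dom_int])
    show "AE t in lborel. norm (J \<tau> t) \<le> norm (dom t)"
      by (intro AE_I2 order_trans[OF J_le[OF that]]) simp
  qed simp
  have J_lim: "((\<lambda>\<tau>. \<integral>t. J \<tau> t \<partial>lborel) \<longlongrightarrow> 0) at_top"
  proof -
    have "((\<lambda>\<tau>. \<integral>t. J \<tau> t \<partial>lborel) \<longlongrightarrow> (\<integral>t. (0::real) \<partial>(lborel::real measure))) at_top"
    proof (rule integral_dominated_convergence_at_top[OF _ _ dom_int])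
      show "\<forall>\<^sub>F \<tau> in at_top. AE t in lborel. norm (J \<tau> t) \<le> dom t"
        using eventually_ge_at_top[of 1] by eventually_elim (intro AE_I2 J_le)
      show "AE t in lborel. ((\<lambda>\<tau>. J \<tau> t) \<longlongrightarrow> 0) at_top"
      proof (rule AE_I2)
        fix t
        have "((\<lambda>\<tau>. 2 * C * \<beta> t / \<tau>) \<longlongrightarrow> 0) at_top"
          by (rule real_tendsto_divide_at_top[OF tendsto_const filterlim_ident])
        then have "((\<lambda>\<tau>. log 2 (1 + 2 * C * \<beta> t / \<tau>)) \<longlongrightarrow> log 2 (1 + 0)) at_top"
          by (intro tendsto_intros) auto
        then have "((\<lambda>\<tau>. indicator {0<..} t * (?m t * (real ?n * log 2 (1 + 2 * C * \<beta> t / \<tau>))))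
            \<longlongrightarrow> indicator {0<..} t * (?m t * (real ?n * log 2 (1 + 0)))) at_top"
          by (intro tendsto_mult tendsto_const)
        then show "((\<lambda>\<tau>. J \<tau> t) \<longlongrightarrow> 0) at_top" by (simp add: J_def)
      qed
    qed auto
    then show ?thesis by simp
  qed
  \<comment> \<open>The enclosing cube bounds \<open>log 2 (?m t)\<close> from above and makes the
    positive part of \<open>g\<close> integrable; the layered entropy can thus degenerate only to
    minus infinity.\<close>
  have g_le: "g t \<le> real ?n * m t + real ?n * (m t * log 2 (1 + ?r t))" for t
  proof (cases "t > 0 \<and> ?m t \<noteq> 0")
    case True
    then have t: "t > 0" and m: "0 < ?m t" by (auto simp: zero_less_measure_iff)
    have "log 2 (?m t) \<le> log 2 ((2 * ?r t) ^ ?n)"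
      using m measure_superlevel_le[OF pdf tail t] r_pos[OF t m] by (subst log_le_cancel_iff) auto
    also have "\<dots> = real ?n * (1 + log 2 (?r t))" using r_pos[OF t m] by (simp add: log_nat_power log_mult algebra_simps)
    also have "\<dots> \<le> real ?n * (1 + log 2 (1 + ?r t))" using r_pos[OF t m] by (intro mult_left_mono) auto
    finally have "?m t * log 2 (?m t) \<le> ?m t * (real ?n * (1 + log 2 (1 + ?r t)))"
      by (intro mult_left_mono) auto
    then show ?thesis using t by (simp add: g_def m_def algebra_simps)
  next
    case False
    then have "g t = 0" by (auto simp: g_def)
    moreover have "0 \<le> real ?n * m t + real ?n * (m t * log 2 (1 + ?r t))"
      by (intro add_nonneg_nonneg mult_nonneg_nonneg) (auto simp: m_def log_r0)
    ultimately show ?thesis by simp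
  qed
  have g_pos_fin: "(\<integral>\<^sup>+t. ennreal (g t) \<partial>lborel) < \<infinity>"
  proof -
    have int: "integrable lborel (\<lambda>t. real ?n * m t + real ?n * (m t * log 2 (1 + ?r t)))"
      using m_int(1) mr_int by auto
    have "(\<integral>\<^sup>+t. ennreal (g t) \<partial>lborel) \<le> (\<integral>\<^sup>+t. ennreal (norm (real ?n * m t + real ?n * (m t * log 2 (1 + ?r t)))) \<partial>lborel)"
      by (intro nn_integral_mono ennreal_leI order_trans[OF g_le]) simp
    also have "\<dots> < \<infinity>" using int unfolding integrable_iff_bounded by simp
    finally show ?thesis .
  qed
  have h: "layered_entropy f = enn2ereal (\<integral>\<^sup>+t. ennreal (g t) \<partial>lborel) - enn2ereal (\<integral>\<^sup>+t. ennreal (- g t) \<partial>lborel)"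
  proof -
    have "(\<integral>\<^sup>+t\<in>{0<..}. ennreal (?m t * log 2 (?m t)) \<partial>lborel) = (\<integral>\<^sup>+t. ennreal (g t) \<partial>lborel)"
      "(\<integral>\<^sup>+t\<in>{0<..}. ennreal (- (?m t * log 2 (?m t))) \<partial>lborel) = (\<integral>\<^sup>+t. ennreal (- g t) \<partial>lborel)"
      by (intro nn_integral_cong; auto simp: g_def indicator_def)+
    then show ?thesis by (simp add: layered_entropy_def ext_integral_pos_def)
  qed

  \<comment> \<open>Comparison with the layered entropy\<close>
  have "normalized_entropy (lrsuq_state f ?P) (lrsuq f (mat 1) ?P \<beta>) \<le> - layered_entropy f + ereal (log 2 (exp 1))"
  \<comment> \<open>With a divergent negative part the layered entropy is minus infinity, so the
    right side is plus infinity.\<close>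
  proof (cases "(\<integral>\<^sup>+t. ennreal (- g t) \<partial>lborel) = \<infinity>")
    case True
    then have "layered_entropy f = - \<infinity>"
      using g_pos_fin unfolding h by (cases "\<integral>\<^sup>+t. ennreal (g t) \<partial>lborel") auto
    then show ?thesis by simp
  next
    case False
    have g_int: "integrable lborel g"
      using False g_pos_fin unfolding real_integrable_def by auto
    have hg: "layered_entropy f = ereal (\<integral>t. g t \<partial>lborel)"
    proof -
      obtain a b where ab: "0 \<le> a" "0 \<le> b" "(\<integral>\<^sup>+t. ennreal (g t) \<partial>lborel) = ennreal a" "(\<integral>\<^sup>+t. ennreal (- g t) \<partial>lborel) = ennreal b"
        using False g_pos_fin by (cases "\<integral>\<^sup>+t. ennreal (g t) \<partial>lborel"; cases "\<integral>\<^sup>+t. ennreal (- g t) \<partial>lborel") auto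
      show ?thesis unfolding h real_lebesgue_integral_def[OF g_int] ab using ab by (simp add: enn2ereal_ennreal)
    qed
    define h where "h = (\<integral>t. g t \<partial>lborel)"
    define e where "e = log 2 (exp 1 :: real)"
    let ?H = "\<lambda>\<tau>. cond_entropy (uniform_measure lborel (cball 0 \<tau>) \<Otimes>\<^sub>M lrsuq_state f ?P) (lrsuq_state f ?P)
        (\<lambda>(x, s). lrsuq f (mat 1) ?P \<beta> x s) snd"
    have bound: "enn2ereal (?H \<tau>) - ereal (log 2 (measure lborel (cball (0::real^'n) \<tau>)))
        \<le> ereal ((\<integral>t. J \<tau> t \<partial>lborel) - h + e)" if \<tau>: "1 \<le> \<tau>" for \<tau>
    proof -
      \<comment> \<open>The integrand of the level average, with its logarithm split by factoring
        \<open>\<tau>\<close> out of the radius of the enlarged ball. Since \<open>m\<close> has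
        integral 1, the four terms integrate to those of \<open>F_eq\<close>.\<close>
      define F where "F t = log 2 (V * \<tau> ^ ?n) * m t + J \<tau> t - g t + e * m t" for t
      have F_int: "integrable lborel F"
        unfolding F_def using m_int(1) J_int[OF \<tau>] g_int by auto
      have F_eq: "(\<integral>t. F t \<partial>lborel) = log 2 (V * \<tau> ^ ?n) + (\<integral>t. J \<tau> t \<partial>lborel) - h + e"
        unfolding F_def h_def using m_int J_int[OF \<tau>] g_int by simp
      have F_layer: "0 \<le> F t \<and> ennreal (?m t) * (ennreal (log 2 (measure lborel (cball (0::real^'n) (\<tau> + 2 * C * \<beta> t)) / ?m t))
          + ennreal (log 2 (exp 1))) * indicator {0<..} t = ennreal (F t)" for t
      proof (cases "t > 0 \<and> ?m t \<noteq> 0")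
        case False
        then show ?thesis by (auto simp: F_def m_def J_def g_def)
      next
        case True
        then have t: "t > 0" and m: "0 < ?m t" by (auto simp: zero_less_measure_iff)
        let ?B = "cball (0::real^'n) (\<tau> + 2 * C * \<beta> t)"
        have b0: "0 \<le> \<beta> t" using r0 by (simp add: \<beta>_def)
        \<comment> \<open>The enlarged ball contains the superlevel set, so the logarithm is
          nonnegative and its conversion to \<open>ennreal\<close> is exact.\<close>
        have "?m t \<le> measure lborel ?B"
        proof (rule measure_mono_fmeasurable)
          show "superlevel f t \<subseteq> ?B"
          proof
            fix z assume "z \<in> superlevel f t"
            then obtain q where q: "q \<in> ?P" "z = \<beta> t *\<^sub>R q" using LP[OF t] by auto
            have "norm z = \<beta> t * norm q" using q b0 by simp
            also have "\<dots> \<le> \<beta> t * C" using q C b0 by (intro mult_left_mono) auto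
            also have "\<dots> \<le> \<tau> + 2 * C * \<beta> t" using \<tau> C b0 by (simp add: algebra_simps)
            finally show "z \<in> ?B" by simp
          qed
        qed (use superlevel_sets[OF pdf] in \<open>auto intro!: fmeasurableI emeasure_bounded_finite\<close>)
        then have "1 \<le> measure lborel ?B / ?m t" using m by (simp add: pos_le_divide_eq)
        then have l0: "0 \<le> log 2 (measure lborel ?B / ?m t)"
          by (subst zero_le_log_cancel_iff; linarith)
        have nn: "0 \<le> 2 * C * \<beta> t / \<tau>" using C b0 \<tau> by simp
        have "measure lborel ?B = V * (\<tau> * (1 + 2 * C * \<beta> t / \<tau>)) ^ ?n"
          using \<tau> C b0 by (subst ball) (auto simp: algebra_simps)
        also have "\<dots> = V * \<tau> ^ ?n * (1 + 2 * C * \<beta> t / \<tau>) ^ ?n" by (simp only: power_mult_distrib mult.assoc)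
        finally have split: "log 2 (measure lborel ?B / ?m t)
            = log 2 (V * \<tau> ^ ?n) + real ?n * log 2 (1 + 2 * C * \<beta> t / \<tau>) - log 2 (?m t)"
          using V \<tau> nn m by (simp add: log_divide log_mult log_nat_power add_pos_nonneg)
        have Ft: "F t = ?m t * (log 2 (measure lborel ?B / ?m t) + e)"
          unfolding split using t by (simp add: F_def m_def J_def g_def algebra_simps)
        have e0: "0 \<le> e" by (simp add: e_def)
        show ?thesis
          unfolding Ft e_def[symmetric] using t l0 e0
          by (simp add: ennreal_mult ennreal_plus)
      qed
      have "?H \<tau> \<le> (\<integral>\<^sup>+t. ennreal (F t) \<partial>lborel)"
        using cond_entropy_lrsuq_le[OF pdf \<beta>_meas bdd LP \<beta>_pos C(2), of \<tau>] \<tau>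
        unfolding F_layer[THEN conjunct2] by linarith
      also have "\<dots> = ennreal (\<integral>t. F t \<partial>lborel)"
        using F_layer by (intro nn_integral_eq_integral F_int) auto
      finally have "enn2ereal (?H \<tau>) \<le> enn2ereal (ennreal (\<integral>t. F t \<partial>lborel))"
        by (simp add: less_eq_ennreal.rep_eq)
      also have "\<dots> = ereal (\<integral>t. F t \<partial>lborel)"
        using F_layer by (intro enn2ereal_ennreal integral_nonneg) auto
      \<comment> \<open>The subtraction cancels the first term of \<open>F_eq\<close>; what is left
        converges as \<open>\<tau>\<close> grows.\<close>
      finally have "enn2ereal (?H \<tau>) - ereal (log 2 (V * \<tau> ^ ?n)) \<le> ereal (\<integral>t. F t \<partial>lborel) - ereal (log 2 (V * \<tau> ^ ?n))"
        by (intro ereal_minus_mono) auto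
      then show ?thesis using ball[of \<tau>] \<tau> by (simp add: F_eq algebra_simps)
    qed
    have "normalized_entropy (lrsuq_state f ?P) (lrsuq f (mat 1) ?P \<beta>)
        \<le> Limsup at_top (\<lambda>\<tau>. ereal ((\<integral>t. J \<tau> t \<partial>lborel) - h + e))"
      unfolding normalized_entropy_def
      by (rule Limsup_mono, use eventually_ge_at_top[of "1::real"] in eventually_elim) (rule bound)
    also have "\<dots> = ereal (0 - h + e)"
      by (intro lim_imp_Limsup trivial_limit_at_top_linorder) (intro tendsto_intros J_lim)
    finally show ?thesis by (simp add: hg h_def e_def)
  qed
  with lrsuq show ?thesis by blast
qed

end
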